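(* Let $M$ be a nonempty smooth manifold of positive dimension and let $(M,F,g)$ be an $(\alpha,\varepsilon)$-metric manifold with $\alpha=+1$. Then the induced generalized almost product structures $$\mathcal F_{F,g,\flat}=\begin{pmatrix}F&0\\ \flat_g&-\varepsilon F^*\end{pmatrix},\qquad \mathcal F_{F,g,\sharp}=\begin{pmatrix}F&\sharp_g\\0&-\varepsilon F^*\end{pmatrix}$$ on $\mathbb TM=TM\oplus T^*M$ are compatible with the natural generalized metric $\mathcal G_0$ if and only if $\varepsilon=-1$, that is, if and only if $(M,F,g)$ is an almost para-Hermitian manifold. In this case, $(\mathcal F_{F,g,\flat},\mathcal G_0)$ and $(\mathcal F_{F,g,\sharp},\mathcal G_0)$ are generalized pseudo-Riemannian almost product structures, with twin metrics $$\Phi_{\mathcal F_{F,g,\flat}}(X+\xi,Y+\eta)=\mathcal G_0(FX+\xi,FY+\eta)+\tfrac12 g(X,Y),$$ $$\Phi_{\mathcal F_{F,g,\sharp}}(X+\xi,Y+\eta)=\mathcal G_0(FX+\xi,FY+\eta)+\tfrac12 g(\sharp_g\xi,\sharp_g\eta)$$ for all $X,Y\in\mathfrak X(M)$, $\xi,\eta\in\Lambda^1(M)$.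
   Context: An $(\alpha,\varepsilon)$-metric manifold $(M,F,g)$, $\alpha,\varepsilon\in\{+1,-1\}$, is a smooth manifold with a Riemannian or pseudo-Riemannian (i.e. nondegenerate, not positive definite) metric $g$ and an $\mathfrak F(M)$-linear $F\colon\mathfrak X(M)\to\mathfrak X(M)$ with $F^2=\alpha Id$ and $g(FX,FY)=\varepsilon g(X,Y)$ for all $X,Y$. For $\alpha=+1,\varepsilon=-1$ it is called almost para-Hermitian. $\mathfrak F(M)$, $\mathfrak X(M)$, $\Lambda^1(M)$ denote smooth functions, vector fields, 1-forms; sections of $\mathbb TM$ are written $X+\xi$. $(\flat_gX)(Y)=g(X,Y)$, $\sharp_g=\flat_g^{-1}$, $(F^*\xi)(X)=\xi(FX)$. Matrix notation: $\begin{pmatrix}H&\sigma\\ \tau&K\end{pmatrix}(X+\xi)=(HX+\sigma\xi)+(\tau X+K\xi)$. A generalized almost product structure is an $\mathfrak F(M)$-linear endomorphism $\mathcal F$ of $\Gamma(\mathbb TM)$ with $\mathcal F^2=Id$. $\mathcal G_0(X+\xi,Y+\eta)=\frac12(\xi(Y)+\eta(X))$. An endomorphism $\mathcal K$ is compatible with a metric $\mathcal G$ on $\mathbb TM$ if there is $\delta\in\{+1,-1\}$ with $\mathcal G(\mathcal Ku,\mathcal Kv)=\delta\,\mathcal G(u,v)$ for all sections $u,v$. $(\mathcal F,\mathcal G)$ with $\mathcal F^2=Id$ and $\mathcal G$ not positive definite is generalized pseudo-Riemannian almost product if $\mathcal G(\mathcal Fu,\mathcal Fv)=\mathcal G(u,v)$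 for all $u,v$; its twin metric is $\Phi_{\mathcal F}(u,v)=\mathcal G(\mathcal Fu,v)$. *)

theory Defs
  imports "HOL-Analysis.Analysis" "HOL-Library.Function_Algebras"
begin

text \<open>Pointwise scalar multiplication, so that fields of (co)tangent vectors, and the
  (co)tangent vectors themselves, are elements of real vector spaces.\<close>

instantiation "fun" :: (type, real_vector) real_vector
begin

definition scaleR_fun :: "real \<Rightarrow> ('a \<Rightarrow> 'b) \<Rightarrow> 'a \<Rightarrow> 'b" where
  "scaleR_fun r f = (\<lambda>x. r *\<^sub>R f x)"

instance
  by standard
    (simp_all add: scaleR_fun_def fun_eq_iff scaleR_add_right scaleR_add_left)

end

section \<open>Smooth manifolds\<close>

text \<open>Only meant for open \<open>S\<close>: continuity of the highest partial derivatives is the base case.\<close>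

fun C_k_on :: "nat \<Rightarrow> 'a::real_normed_vector set \<Rightarrow> ('a \<Rightarrow> 'b::real_normed_vector) \<Rightarrow> bool" where
  "C_k_on 0 S f \<longleftrightarrow> continuous_on S f"
| "C_k_on (Suc k) S f \<longleftrightarrow>
     (\<forall>x\<in>S. f differentiable (at x)) \<and>
     (\<forall>v. C_k_on k S (\<lambda>x. frechet_derivative f (at x) v))"

definition smooth_on :: "'a::real_normed_vector set \<Rightarrow> ('a \<Rightarrow> 'b::real_normed_vector) \<Rightarrow> bool" where
  "smooth_on S f \<longleftrightarrow> (\<forall>k. C_k_on k S f)"

text \<open>A chart is a pair of a domain and a coordinate map; the values of the coordinate map
  outside the domain are irrelevant.\<close>

type_synonym ('a, 'n) chart = "'a set \<times> ('a \<Rightarrow> real ^ 'n)"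

definition chart_inv :: "('a, 'n) chart \<Rightarrow> real ^ 'n \<Rightarrow> 'a" where
  "chart_inv c = inv_into (fst c) (snd c)"

definition is_chart :: "('a::topological_space, 'n::finite) chart \<Rightarrow> bool" where
  "is_chart c \<longleftrightarrow> open (fst c) \<and> open (snd c ` fst c) \<and>
     homeomorphism (fst c) (snd c ` fst c) (snd c) (chart_inv c)"

text \<open>The underlying set of the manifold is the whole type \<open>'a\<close> (hence nonempty), which carries
  its Hausdorff second countable topology; its dimension is \<open>CARD('n) \<ge> 1\<close>. The smooth structure
  is the one generated by the atlas, which need not be maximal.\<close>

definition smooth_manifold ::
    "('a::{t2_space,second_countable_topology}, 'n::finite) chart set \<Rightarrow> bool" where
  "smooth_manifold A \<longleftrightarrow>
     (\<forall>c\<in>A. is_chart c) \<and> (\<Union>c\<in>A. fst c) = UNIV \<and>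
     (\<forall>c\<in>A. \<forall>d\<in>A. smooth_on (snd c ` (fst c \<inter> fst d)) (snd d \<circ> chart_inv c))"

definition smooth_functions :: "('a, 'n::finite) chart set \<Rightarrow> ('a \<Rightarrow> real) set" where
  "smooth_functions A = {f. \<forall>c\<in>A. smooth_on (snd c ` fst c) (f \<circ> chart_inv c)}"

text \<open>A tangent vector at \<open>p\<close> is the family of its coordinate vectors with respect to all
  charts around \<open>p\<close>, related by the Jacobians of the transition maps.\<close>

type_synonym ('a, 'n) tangent = "('a, 'n) chart \<Rightarrow> real ^ 'n"
type_synonym ('a, 'n) cotangent = "('a, 'n) tangent \<Rightarrow> real"

definition tangent_space :: "('a, 'n::finite) chart set \<Rightarrow> 'a \<Rightarrow> ('a, 'n) tangent set" where
  "tangent_space A p =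
     {v. (\<forall>c. c \<notin> A \<or> p \<notin> fst c \<longrightarrow> v c = 0) \<and>
         (\<forall>c\<in>A. \<forall>d\<in>A. p \<in> fst c \<inter> fst d \<longrightarrow>
            v d = frechet_derivative (snd d \<circ> chart_inv c) (at (snd c p)) (v c))}"

text \<open>Covectors vanish outside the tangent space, so that they are determined by
  their values on it.\<close>

definition cotangent_space :: "('a, 'n::finite) chart set \<Rightarrow> 'a \<Rightarrow> ('a, 'n) cotangent set" where
  "cotangent_space A p =
     {\<omega>. (\<forall>v. v \<notin> tangent_space A p \<longrightarrow> \<omega> v = 0) \<and>
         (\<forall>v\<in>tangent_space A p. \<forall>w\<in>tangent_space A p. \<forall>a b.
            \<omega> (a *\<^sub>R v + b *\<^sub>R w) = a * \<omega> v + b * \<omega> w)}"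

definition vector_fields :: "('a, 'n::finite) chart set \<Rightarrow> ('a \<Rightarrow> ('a, 'n) tangent) set" where
  "vector_fields A =
     {X. (\<forall>p. X p \<in> tangent_space A p) \<and>
         (\<forall>c\<in>A. smooth_on (snd c ` fst c) (\<lambda>x. X (chart_inv c x) c))}"

definition pairing :: "('a \<Rightarrow> 'v \<Rightarrow> real) \<Rightarrow> ('a \<Rightarrow> 'v) \<Rightarrow> 'a \<Rightarrow> real" where
  "pairing \<xi> X = (\<lambda>p. \<xi> p (X p))"

text \<open>A field of covectors, or below of bilinear forms, is smooth if its values on smooth
  sections are smooth functions; as \<open>M\<close> is Hausdorff, bump functions show that this amounts to
  smooth components in every chart.\<close>

definition one_forms :: "('a, 'n::finite) chart set \<Rightarrow> ('a \<Rightarrow> ('a, 'n) cotangent) set" where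
  "one_forms A =
     {\<xi>. (\<forall>p. \<xi> p \<in> cotangent_space A p) \<and>
         (\<forall>X\<in>vector_fields A. pairing \<xi> X \<in> smooth_functions A)}"

section \<open>Metrics and linear operators on vector bundles\<close>

text \<open>In this section \<open>E p\<close> is the fibre of a vector bundle at \<open>p\<close> and \<open>\<Gamma>\<close> is the set
  of its smooth sections.\<close>

definition on_sections :: "('a \<Rightarrow> 'v \<Rightarrow> 'v \<Rightarrow> real) \<Rightarrow> ('a \<Rightarrow> 'v) \<Rightarrow> ('a \<Rightarrow> 'v) \<Rightarrow> 'a \<Rightarrow> real" where
  "on_sections h s t = (\<lambda>p. h p (s p) (t p))"

definition bundle_metric ::
    "('a, 'n::finite) chart set \<Rightarrow> ('a \<Rightarrow> 'v::real_vector set) \<Rightarrow> ('a \<Rightarrow> 'v) set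
       \<Rightarrow> ('a \<Rightarrow> 'v \<Rightarrow> 'v \<Rightarrow> real) \<Rightarrow> bool" where
  "bundle_metric A E \<Gamma> h \<longleftrightarrow>
     (\<forall>p. \<forall>u\<in>E p. \<forall>v\<in>E p. h p u v = h p v u) \<and>
     (\<forall>p. \<forall>u\<in>E p. \<forall>v\<in>E p. \<forall>w\<in>E p. \<forall>a b.
        h p (a *\<^sub>R u + b *\<^sub>R v) w = a * h p u w + b * h p v w) \<and>
     (\<forall>p. \<forall>u\<in>E p. (\<forall>v\<in>E p. h p u v = 0) \<longrightarrow> u = 0) \<and>
     (\<forall>s\<in>\<Gamma>. \<forall>t\<in>\<Gamma>. on_sections h s t \<in> smooth_functions A)"

definition positive_definite ::
    "('a \<Rightarrow> 'v::real_vector set) \<Rightarrow> ('a \<Rightarrow> 'v \<Rightarrow> 'v \<Rightarrow> real) \<Rightarrow> bool" where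
  "positive_definite E h \<longleftrightarrow> (\<forall>p. \<forall>u\<in>E p. u \<noteq> 0 \<longrightarrow> h p u u > 0)"

definition module_endomorphism ::
    "('a, 'n::finite) chart set \<Rightarrow> ('a \<Rightarrow> 'v::real_vector) set
       \<Rightarrow> (('a \<Rightarrow> 'v) \<Rightarrow> ('a \<Rightarrow> 'v)) \<Rightarrow> bool" where
  "module_endomorphism A \<Gamma> L \<longleftrightarrow>
     (\<forall>s\<in>\<Gamma>. L s \<in> \<Gamma>) \<and>
     (\<forall>s\<in>\<Gamma>. \<forall>t\<in>\<Gamma>. L (s + t) = L s + L t) \<and>
     (\<forall>f\<in>smooth_functions A. \<forall>s\<in>\<Gamma>. L (\<lambda>p. f p *\<^sub>R s p) = (\<lambda>p. f p *\<^sub>R L s p))"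

section \<open>\<open>(\<alpha>,\<epsilon>)\<close>-metric manifolds\<close>

type_synonym ('a, 'n) vfield = "'a \<Rightarrow> ('a, 'n) tangent"
type_synonym ('a, 'n) form = "'a \<Rightarrow> ('a, 'n) cotangent"
type_synonym ('a, 'n) metric = "'a \<Rightarrow> ('a, 'n) tangent \<Rightarrow> ('a, 'n) tangent \<Rightarrow> real"

definition riemannian_metric :: "('a, 'n::finite) chart set \<Rightarrow> ('a, 'n) metric \<Rightarrow> bool" where
  "riemannian_metric A g \<longleftrightarrow>
     bundle_metric A (tangent_space A) (vector_fields A) g \<and> positive_definite (tangent_space A) g"

definition pseudo_riemannian_metric :: "('a, 'n::finite) chart set \<Rightarrow> ('a, 'n) metric \<Rightarrow> bool" where
  "pseudo_riemannian_metric A g \<longleftrightarrow>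
     bundle_metric A (tangent_space A) (vector_fields A) g \<and> \<not> positive_definite (tangent_space A) g"

definition metric_manifold ::
    "real \<Rightarrow> real \<Rightarrow> ('a::{t2_space,second_countable_topology}, 'n::finite) chart set
       \<Rightarrow> (('a, 'n) vfield \<Rightarrow> ('a, 'n) vfield) \<Rightarrow> ('a, 'n) metric \<Rightarrow> bool" where
  "metric_manifold \<alpha> \<epsilon> A F g \<longleftrightarrow>
     \<alpha> \<in> {1, -1} \<and> \<epsilon> \<in> {1, -1} \<and> smooth_manifold A \<and>
     (riemannian_metric A g \<or> pseudo_riemannian_metric A g) \<and>
     module_endomorphism A (vector_fields A) F \<and>
     (\<forall>X\<in>vector_fields A. F (F X) = \<alpha> *\<^sub>R X) \<and>
     (\<forall>X\<in>vector_fields A. \<forall>Y\<in>vector_fields A.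
        on_sections g (F X) (F Y) = \<epsilon> *\<^sub>R on_sections g X Y)"

definition almost_para_hermitian ::
    "('a::{t2_space,second_countable_topology}, 'n::finite) chart set
       \<Rightarrow> (('a, 'n) vfield \<Rightarrow> ('a, 'n) vfield) \<Rightarrow> ('a, 'n) metric \<Rightarrow> bool" where
  "almost_para_hermitian A F g \<longleftrightarrow> metric_manifold 1 (-1) A F g"

definition flat :: "('a, 'n::finite) chart set \<Rightarrow> ('a, 'n) metric \<Rightarrow> ('a, 'n) vfield \<Rightarrow> ('a, 'n) form" where
  "flat A g X = (\<lambda>p v. if v \<in> tangent_space A p then g p (X p) v else 0)"

definition sharp :: "('a, 'n::finite) chart set \<Rightarrow> ('a, 'n) metric \<Rightarrow> ('a, 'n) form \<Rightarrow> ('a, 'n) vfield" where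
  "sharp A g = inv_into (vector_fields A) (flat A g)"

text \<open>\<open>F\<close> acts on vector fields only, so \<open>F\<^sup>*\<xi>\<close> is given by its values on them; by
  \<open>\<FF>(M)\<close>-linearity of \<open>F\<close> there is exactly one such 1-form.\<close>

definition dual_map ::
    "('a, 'n::finite) chart set \<Rightarrow> (('a, 'n) vfield \<Rightarrow> ('a, 'n) vfield)
       \<Rightarrow> ('a, 'n) form \<Rightarrow> ('a, 'n) form" where
  "dual_map A F \<xi> =
     (THE \<zeta>. \<zeta> \<in> one_forms A \<and> (\<forall>X\<in>vector_fields A. pairing \<zeta> X = pairing \<xi> (F X)))"

section \<open>Structures on the generalized tangent bundle\<close>

type_synonym ('a, 'n) gtangent = "('a, 'n) tangent \<times> ('a, 'n) cotangent"
type_synonym ('a, 'n) gsection = "'a \<Rightarrow> ('a, 'n) gtangent"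
type_synonym ('a, 'n) gmetric = "'a \<Rightarrow> ('a, 'n) gtangent \<Rightarrow> ('a, 'n) gtangent \<Rightarrow> real"

definition gtangent_space :: "('a, 'n::finite) chart set \<Rightarrow> 'a \<Rightarrow> ('a, 'n) gtangent set" where
  "gtangent_space A p = tangent_space A p \<times> cotangent_space A p"

definition gsections :: "('a, 'n::finite) chart set \<Rightarrow> ('a, 'n) gsection set" where
  "gsections A = {u. fst \<circ> u \<in> vector_fields A \<and> snd \<circ> u \<in> one_forms A}"

definition gsec :: "('a, 'n) vfield \<Rightarrow> ('a, 'n) form \<Rightarrow> ('a, 'n) gsection" (infix "\<oplus>" 64) where
  "X \<oplus> \<xi> = (\<lambda>p. (X p, \<xi> p))"

definition block ::
    "(('a, 'n::finite) vfield \<Rightarrow> ('a, 'n) vfield) \<Rightarrow> (('a, 'n) form \<Rightarrow> ('a, 'n) vfield)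
       \<Rightarrow> (('a, 'n) vfield \<Rightarrow> ('a, 'n) form) \<Rightarrow> (('a, 'n) form \<Rightarrow> ('a, 'n) form)
       \<Rightarrow> ('a, 'n) gsection \<Rightarrow> ('a, 'n) gsection" where
  "block H \<sigma> \<tau> K u =
     (H (fst \<circ> u) + \<sigma> (snd \<circ> u)) \<oplus> (\<tau> (fst \<circ> u) + K (snd \<circ> u))"

definition gen_almost_product ::
    "('a, 'n::finite) chart set \<Rightarrow> (('a, 'n) gsection \<Rightarrow> ('a, 'n) gsection) \<Rightarrow> bool" where
  "gen_almost_product A K \<longleftrightarrow>
     module_endomorphism A (gsections A) K \<and> (\<forall>u\<in>gsections A. K (K u) = u)"

definition natural_gmetric :: "('a, 'n) gmetric" ("\<G>\<^sub>0") where
  "\<G>\<^sub>0 = (\<lambda>p u v. (1/2) * (snd u (fst v) + snd v (fst u)))"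

definition compatible ::
    "('a, 'n::finite) chart set \<Rightarrow> (('a, 'n) gsection \<Rightarrow> ('a, 'n) gsection) \<Rightarrow> ('a, 'n) gmetric \<Rightarrow> bool" where
  "compatible A K G \<longleftrightarrow>
     (\<exists>\<delta>\<in>{1, -1}. \<forall>u\<in>gsections A. \<forall>v\<in>gsections A.
        on_sections G (K u) (K v) = \<delta> *\<^sub>R on_sections G u v)"

definition gen_pseudo_riemannian_almost_product ::
    "('a, 'n::finite) chart set \<Rightarrow> (('a, 'n) gsection \<Rightarrow> ('a, 'n) gsection) \<Rightarrow> ('a, 'n) gmetric \<Rightarrow> bool" where
  "gen_pseudo_riemannian_almost_product A K G \<longleftrightarrow>
     gen_almost_product A K \<and>
     bundle_metric A (gtangent_space A) (gsections A) G \<and>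
     \<not> positive_definite (gtangent_space A) G \<and>
     (\<forall>u\<in>gsections A. \<forall>v\<in>gsections A. on_sections G (K u) (K v) = on_sections G u v)"

definition twin_metric ::
    "('a, 'n) gmetric \<Rightarrow> (('a, 'n) gsection \<Rightarrow> ('a, 'n) gsection)
       \<Rightarrow> ('a, 'n) gsection \<Rightarrow> ('a, 'n) gsection \<Rightarrow> 'a \<Rightarrow> real" where
  "twin_metric G K u v = on_sections G (K u) v"

definition F_flat ::
    "real \<Rightarrow> ('a, 'n::finite) chart set \<Rightarrow> (('a, 'n) vfield \<Rightarrow> ('a, 'n) vfield) \<Rightarrow> ('a, 'n) metric
       \<Rightarrow> ('a, 'n) gsection \<Rightarrow> ('a, 'n) gsection" where
  "F_flat \<epsilon> A F g = block F (\<lambda>\<xi>. 0) (flat A g) (\<lambda>\<xi>. (- \<epsilon>) *\<^sub>R dual_map A F \<xi>)"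

definition F_sharp ::
    "real \<Rightarrow> ('a, 'n::finite) chart set \<Rightarrow> (('a, 'n) vfield \<Rightarrow> ('a, 'n) vfield) \<Rightarrow> ('a, 'n) metric
       \<Rightarrow> ('a, 'n) gsection \<Rightarrow> ('a, 'n) gsection" where
  "F_sharp \<epsilon> A F g = block F (sharp A g) (\<lambda>X. 0) (\<lambda>\<xi>. (- \<epsilon>) *\<^sub>R dual_map A F \<xi>)"

end

theory Submission
  imports Defs
begin

text \<open>
  Since \<open>\<flat>\<^sub>g\<close> is bijective, every section of the generalized tangent bundle has the form
  \<open>X + \<flat>\<^sub>g Z\<close>. As \<open>F\<^sup>2 = Id\<close>, the operator \<open>F\<close> is \<open>\<epsilon>\<close>-selfadjoint with respect to \<open>g\<close>, whence
  \<open>F\<^sup>*(\<flat>\<^sub>g Z) = \<epsilon> \<flat>\<^sub>g (F Z)\<close>. In these terms the two structures are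
  \<open>X + \<flat>\<^sub>g Z \<mapsto> F X + \<flat>\<^sub>g (X - F Z)\<close> and \<open>X + \<flat>\<^sub>g Z \<mapsto> (F X + Z) - \<flat>\<^sub>g (F Z)\<close>, and all claims
  reduce to bilinear algebra with \<open>g\<close>: the pullback of \<open>\<G>\<^sub>0\<close> differs from \<open>- \<epsilon> \<G>\<^sub>0\<close> by the terms
  \<open>\<plusminus> (1 + \<epsilon>)/2 \<sqdot> g(\<sqdot>, F \<sqdot>)\<close>, which vanish identically only for \<open>\<epsilon> = -1\<close>.
  The analytic input is the surjectivity of \<open>\<flat>\<^sub>g\<close> on smooth sections, obtained from bump functions
  and Cramer's rule in local frames.
\<close>

section \<open>Calculus of smooth maps\<close>

lemma C_k_on_subset: "C_k_on k S f \<Longrightarrow> T \<subseteq> S \<Longrightarrow> C_k_on k T f"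
  by (induction k arbitrary: f) (auto intro: continuous_on_subset)

text \<open>A derivative at a point depends only on the values near it, so on an open set agreement
  of the functions passes to all directional derivatives. Both functions vary in the induction
  because these derivatives take their places.\<close>

lemma C_k_on_cong:
  assumes "open S" "\<And>x. x \<in> S \<Longrightarrow> f x = g x"
  shows "C_k_on k S f \<longleftrightarrow> C_k_on k S g"
proof -
  have imp: "C_k_on k S f \<Longrightarrow> C_k_on k S g" if "\<And>x. x \<in> S \<Longrightarrow> f x = g x" for f g :: "'a \<Rightarrow> 'b"
    using that
  proof (induction k arbitrary: f g)
    case 0
    then show ?case using continuous_on_eq by auto
  next
    case (Suc k)
    have der: "(g has_derivative frechet_derivative f (at x)) (at x)" if "x \<in> S" for x
      using Suc.prems that
      by (auto simp: frechet_derivative_works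
          intro: has_derivative_transform_within_open[OF _ assms(1) that])
    have "frechet_derivative f (at x) = frechet_derivative g (at x)" if "x \<in> S" for x
      using der[OF that] by (rule frechet_derivative_at)
    then have "C_k_on k S (\<lambda>x. frechet_derivative g (at x) v)" for v
      using Suc.IH[of "\<lambda>x. frechet_derivative f (at x) v" "\<lambda>x. frechet_derivative g (at x) v"]
        Suc.prems(1) by simp
    with der show ?case by (auto simp: differentiable_def)
  qed
  show ?thesis using imp[of f g] imp[of g f] assms(2) by auto
qed

text \<open>Uniqueness of derivatives allows an explicit formula to replace the choice made by
  \<open>frechet_derivative\<close>. The calculus rules below are inductions on the order through
  this rule.\<close>

lemma C_k_on_SucI:
  assumes "open S" "\<And>x. x \<in> S \<Longrightarrow> (f has_derivative f' x) (at x)"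
    "\<And>v. C_k_on k S (\<lambda>x. f' x v)"
  shows "C_k_on (Suc k) S f"
proof -
  have "C_k_on k S (\<lambda>x. frechet_derivative f (at x) v)" for v
    using C_k_on_cong[OF assms(1), of "\<lambda>x. f' x v" "\<lambda>x. frechet_derivative f (at x) v"]
      assms(3)[of v] frechet_derivative_at[OF assms(2)] by auto
  then show ?thesis using assms(2) by (auto simp: differentiable_def)
qed

lemma C_k_on_Suc_has_derivative:
  "C_k_on (Suc k) S f \<Longrightarrow> x \<in> S \<Longrightarrow> (f has_derivative frechet_derivative f (at x)) (at x)"
  by (simp add: frechet_derivative_works[symmetric])

lemma C_k_on_SucD: "C_k_on (Suc k) S f \<Longrightarrow> C_k_on k S f"
proof (induction k arbitrary: f)
  case 0
  then show ?case
    by (auto intro!: continuous_at_imp_continuous_on differentiable_imp_continuous_within)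
next
  case (Suc k)
  then show ?case by (metis C_k_on.simps(2))
qed

lemma C_k_on_const [simp]: "C_k_on k S (\<lambda>x. c)"
proof (induction k arbitrary: c)
  case (Suc k)
  have "frechet_derivative (\<lambda>x::'a. c) (at x) = (\<lambda>v. 0)" for x
    by (rule frechet_derivative_at[symmetric]) simp
  with Suc show ?case by simp
qed simp

lemma C_k_on_linear: "bounded_linear L \<Longrightarrow> C_k_on k S L"
proof (cases k)
  case 0
  then show "bounded_linear L \<Longrightarrow> ?thesis"
    by (simp add: linear_continuous_on)
next
  case (Suc m)
  assume L: "bounded_linear L"
  have "frechet_derivative L (at x) = L" for x
    by (rule frechet_derivative_at[symmetric]) (rule bounded_linear_imp_has_derivative[OF L])
  then show ?thesis
    using Suc L by (simp add: bounded_linear_imp_differentiable)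
qed

lemma C_k_on_add:
  "open S \<Longrightarrow> C_k_on k S f \<Longrightarrow> C_k_on k S g \<Longrightarrow> C_k_on k S (\<lambda>x. f x + g x)"
proof (induction k arbitrary: f g)
  case 0
  then show ?case by (simp add: continuous_on_add)
next
  case (Suc k)
  show ?case
    by (rule C_k_on_SucI[OF Suc.prems(1) has_derivative_add
          [OF Suc.prems(2)[THEN C_k_on_Suc_has_derivative] Suc.prems(3)[THEN C_k_on_Suc_has_derivative]]])
      (use Suc in auto)
qed

lemma C_k_on_sum:
  "open S \<Longrightarrow> (\<And>i. i \<in> I \<Longrightarrow> C_k_on k S (f i)) \<Longrightarrow> C_k_on k S (\<lambda>x. \<Sum>i\<in>I. f i x)"
  by (induction I rule: infinite_finite_induct) (auto intro: C_k_on_add)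

text \<open>By the Leibniz rule each summand of the derivative keeps one factor undifferentiated;
  \<open>C_k_on_SucD\<close> lowers that factor to order \<open>k\<close>, where the induction
  hypothesis applies.\<close>

lemma (in bounded_bilinear) C_k_on:
  "open S \<Longrightarrow> C_k_on k S f \<Longrightarrow> C_k_on k S g \<Longrightarrow> C_k_on k S (\<lambda>x. prod (f x) (g x))"
proof (induction k arbitrary: f g)
  case 0
  then show ?case by (simp add: continuous_on)
next
  case (Suc k)
  show ?case
    by (rule C_k_on_SucI[OF Suc.prems(1) FDERIV
          [OF Suc.prems(2)[THEN C_k_on_Suc_has_derivative] Suc.prems(3)[THEN C_k_on_Suc_has_derivative]]])
      (use Suc Suc.prems(2,3)[THEN C_k_on_SucD] in \<open>auto intro!: C_k_on_add\<close>)
qed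

lemmas C_k_on_mult = bounded_bilinear.C_k_on[OF bounded_bilinear_mult]
lemmas C_k_on_scaleR = bounded_bilinear.C_k_on[OF bounded_bilinear_scaleR]
lemmas C_k_on_inner = bounded_bilinear.C_k_on[OF bounded_bilinear_inner]

lemma C_k_on_prod:
  fixes f :: "'i \<Rightarrow> 'a::real_normed_vector \<Rightarrow> real"
  shows "open S \<Longrightarrow> (\<And>i. i \<in> I \<Longrightarrow> C_k_on k S (f i)) \<Longrightarrow> C_k_on k S (\<lambda>x. \<Prod>i\<in>I. f i x)"
  by (induction I rule: infinite_finite_induct) (auto intro: C_k_on_mult)

text \<open>\<open>C_k_on\<close> speaks of derivatives in fixed directions, whereas the chain rule
  evaluates the derivative of \<open>f\<close> in the moving direction \<open>?g' x v\<close>.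
  Expanding this direction in the finite basis leaves fixed directions \<open>b\<close> with scalar
  coefficients, and the induction hypothesis applies to \<open>\<lambda>y. ?f' y b\<close>.\<close>

lemma C_k_on_compose:
  fixes g :: "'a::real_normed_vector \<Rightarrow> 'b::euclidean_space"
    and f :: "'b \<Rightarrow> 'c::real_normed_vector"
  assumes "open S" "open T" "g ` S \<subseteq> T" "C_k_on k S g" "C_k_on k T f"
  shows "C_k_on k S (\<lambda>x. f (g x))"
  using assms
proof (induction k arbitrary: f)
  case 0
  then show ?case by (auto intro: continuous_on_compose2)
next
  case (Suc k)
  let ?g' = "\<lambda>x. frechet_derivative g (at x)" and ?f' = "\<lambda>x. frechet_derivative f (at x)"
  have der: "((\<lambda>x. f (g x)) has_derivative (\<lambda>v. \<Sum>b\<in>Basis. (?g' x v \<bullet> b) *\<^sub>R ?f' (g x) b)) (at x)"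
    if x: "x \<in> S" for x
  proof -
    have f: "(f has_derivative ?f' (g x)) (at (g x))"
      using Suc.prems x by (intro C_k_on_Suc_has_derivative) auto
    then interpret bounded_linear "?f' (g x)" by (rule has_derivative_bounded_linear)
    have "(\<lambda>v. ?f' (g x) (?g' x v)) = (\<lambda>v. \<Sum>b\<in>Basis. (?g' x v \<bullet> b) *\<^sub>R ?f' (g x) b)"
      by (subst (1) euclidean_representation[symmetric], simp only: sum scaleR)
    moreover have "((\<lambda>x. f (g x)) has_derivative (\<lambda>v. ?f' (g x) (?g' x v))) (at x)"
      using has_derivative_compose[OF C_k_on_Suc_has_derivative[OF Suc.prems(4) x] f] .
    ultimately show ?thesis by (simp only:)
  qed
  show ?case
  proof (rule C_k_on_SucI[OF Suc.prems(1) der])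
    fix v
    have "C_k_on k S (\<lambda>x. ?f' (g x) b)" for b
      using Suc.IH[of "\<lambda>y. ?f' y b"] Suc.prems C_k_on_SucD[OF Suc.prems(4)] by simp
    moreover have "C_k_on k S (\<lambda>x. ?g' x v)" using Suc.prems(4) by simp
    ultimately show "C_k_on k S (\<lambda>x. \<Sum>b\<in>Basis. (?g' x v \<bullet> b) *\<^sub>R ?f' (g x) b)"
      using Suc.prems(1) by (intro C_k_on_sum C_k_on_scaleR C_k_on_inner C_k_on_const)
  qed
qed

text \<open>The derivative of the reciprocal is a product of the reciprocal, the derivative of
  \<open>f\<close> and the reciprocal again, so order \<open>k\<close> for the reciprocal gives
  order \<open>k + 1\<close>.\<close>

lemma C_k_on_inverse:
  fixes f :: "'a::real_normed_vector \<Rightarrow> real"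
  assumes "open S" "\<And>x. x \<in> S \<Longrightarrow> f x \<noteq> 0" "C_k_on k S f"
  shows "C_k_on k S (\<lambda>x. inverse (f x))"
  using assms
proof (induction k)
  case 0
  then show ?case by (auto intro: continuous_on_inverse)
next
  case (Suc k)
  show ?case
  proof (rule C_k_on_SucI[OF Suc.prems(1)
        Deriv.has_derivative_inverse[OF Suc.prems(2) Suc.prems(3)[THEN C_k_on_Suc_has_derivative]]])
    show "C_k_on k S (\<lambda>x. - (inverse (f x) * frechet_derivative f (at x) v * inverse (f x)))" for v
      using Suc C_k_on_SucD[OF Suc.prems(3)]
      by (subst mult_minus1[symmetric]) (intro C_k_on_mult, auto)
  qed
qed

lemma C_k_on_local:
  assumes "\<And>x. x \<in> S \<Longrightarrow> \<exists>T. open T \<and> x \<in> T \<and> C_k_on k T f"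
  shows "C_k_on k S f"
  using assms
proof (induction k arbitrary: f)
  case 0
  have "isCont f x" if "x \<in> S" for x
    using 0[OF that] by (auto simp: continuous_on_eq_continuous_at)
  then show ?case by (simp add: continuous_at_imp_continuous_on)
next
  case (Suc k)
  have "C_k_on k S (\<lambda>x. frechet_derivative f (at x) v)" for v
    by (rule Suc.IH) (use Suc.prems in \<open>metis C_k_on.simps(2)\<close>)
  moreover have "f differentiable at x" if "x \<in> S" for x
    using Suc.prems[OF that] by auto
  ultimately show ?case by simp
qed

section \<open>Smoothness: the closure rules for all orders at once\<close>

lemma smooth_on_subset: "smooth_on S f \<Longrightarrow> T \<subseteq> S \<Longrightarrow> smooth_on T f"
  by (auto simp: smooth_on_def intro: C_k_on_subset)

lemma smooth_on_cong:
  "open S \<Longrightarrow> (\<And>x. x \<in> S \<Longrightarrow> f x = g x) \<Longrightarrow> smooth_on S f \<longleftrightarrow> smooth_on S g"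
  using C_k_on_cong[of S f g] by (auto simp: smooth_on_def)

lemma smooth_on_local:
  assumes "\<And>x. x \<in> S \<Longrightarrow> \<exists>T. open T \<and> x \<in> T \<and> smooth_on T f"
  shows "smooth_on S f"
  unfolding smooth_on_def
proof
  show "C_k_on k S f" for k
    by (rule C_k_on_local) (use assms in \<open>auto simp: smooth_on_def\<close>)
qed

lemma smooth_on_has_derivative:
  "smooth_on S f \<Longrightarrow> x \<in> S \<Longrightarrow> (f has_derivative frechet_derivative f (at x)) (at x)"
  using C_k_on_Suc_has_derivative[of 0 S f x] by (simp only: smooth_on_def)

lemma smooth_on_frechet_derivative:
  assumes "smooth_on S f"
  shows "smooth_on S (\<lambda>x. frechet_derivative f (at x) v)"
proof -
  have "C_k_on (Suc k) S f" for k using assms unfolding smooth_on_def ..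
  then show ?thesis by (simp add: smooth_on_def)
qed

lemma smooth_on_const [simp]: "smooth_on S (\<lambda>x. c)"
  by (simp add: smooth_on_def)

lemma smooth_on_linear: "bounded_linear L \<Longrightarrow> smooth_on S L"
  by (simp add: smooth_on_def C_k_on_linear)

lemma smooth_on_add:
  "open S \<Longrightarrow> smooth_on S f \<Longrightarrow> smooth_on S g \<Longrightarrow> smooth_on S (\<lambda>x. f x + g x)"
  by (simp add: smooth_on_def C_k_on_add)

lemma smooth_on_sum:
  "open S \<Longrightarrow> (\<And>i. i \<in> I \<Longrightarrow> smooth_on S (f i)) \<Longrightarrow> smooth_on S (\<lambda>x. \<Sum>i\<in>I. f i x)"
  by (simp add: smooth_on_def C_k_on_sum)

lemma smooth_on_mult:
  fixes f g :: "'a::real_normed_vector \<Rightarrow> real"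
  shows "open S \<Longrightarrow> smooth_on S f \<Longrightarrow> smooth_on S g \<Longrightarrow> smooth_on S (\<lambda>x. f x * g x)"
  by (simp add: smooth_on_def C_k_on_mult)

lemma smooth_on_scaleR:
  "open S \<Longrightarrow> smooth_on S f \<Longrightarrow> smooth_on S g \<Longrightarrow> smooth_on S (\<lambda>x. f x *\<^sub>R g x)"
  by (simp add: smooth_on_def C_k_on_scaleR)

lemma smooth_on_inner:
  "open S \<Longrightarrow> smooth_on S f \<Longrightarrow> smooth_on S g \<Longrightarrow> smooth_on S (\<lambda>x. f x \<bullet> g x)"
  by (simp add: smooth_on_def C_k_on_inner)

lemma smooth_on_prod:
  fixes f :: "'i \<Rightarrow> 'a::real_normed_vector \<Rightarrow> real"
  shows "open S \<Longrightarrow> (\<And>i. i \<in> I \<Longrightarrow> smooth_on S (f i)) \<Longrightarrow> smooth_on S (\<lambda>x. \<Prod>i\<in>I. f i x)"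
  by (simp add: smooth_on_def C_k_on_prod)

lemma smooth_on_compose:
  fixes g :: "'a::real_normed_vector \<Rightarrow> 'b::euclidean_space"
    and f :: "'b \<Rightarrow> 'c::real_normed_vector"
  shows "smooth_on T f \<Longrightarrow> smooth_on S g \<Longrightarrow> open S \<Longrightarrow> open T \<Longrightarrow> g ` S \<subseteq> T \<Longrightarrow>
    smooth_on S (\<lambda>x. f (g x))"
  by (simp add: smooth_on_def C_k_on_compose)

lemma smooth_on_divide:
  fixes f g :: "'a::real_normed_vector \<Rightarrow> real"
  shows "open S \<Longrightarrow> (\<And>x. x \<in> S \<Longrightarrow> g x \<noteq> 0) \<Longrightarrow> smooth_on S f \<Longrightarrow> smooth_on S g \<Longrightarrow>
    smooth_on S (\<lambda>x. f x / g x)"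
  by (simp add: smooth_on_def divide_inverse C_k_on_mult C_k_on_inverse)

text \<open>The Leibniz formula makes the determinant a polynomial in the entries; this gives the
  smoothness of solutions found by Cramer's rule.\<close>

lemma smooth_on_det:
  fixes M :: "'a::real_normed_vector \<Rightarrow> real ^ 'n ^ 'n"
  assumes "open S" "\<And>i j. smooth_on S (\<lambda>x. M x $ i $ j)"
  shows "smooth_on S (\<lambda>x. det (M x))"
  unfolding det_def using assms by (intro smooth_on_sum smooth_on_mult smooth_on_prod) auto

section \<open>A smooth bump function\<close>

text \<open>The exponent \<open>n\<close> is carried along so that the family is closed under
  differentiation: the derivative of a member combines the members \<open>n + 1\<close> and
  \<open>n + 2\<close>. Only \<open>n = 0\<close> enters the bump function.\<close>

definition flat_exp :: "nat \<Rightarrow> real \<Rightarrow> real" where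
  "flat_exp n t = (if t > 0 then inverse t ^ n * exp (- inverse t) else 0)"

text \<open>This is the difference quotient at 0, where the function vanishes. On the right, with s
  = 1/t, it is s^(n+1) / exp s for s tending to infinity.\<close>

lemma flat_exp_tendsto_0: "((\<lambda>t. flat_exp n t / t) \<longlongrightarrow> 0) (at 0)"
proof -
  have "((\<lambda>t. inverse t ^ Suc n / exp (inverse t)) \<longlongrightarrow> 0) (at_right (0::real))"
    using filterlim_compose[OF tendsto_power_div_exp_0 filterlim_inverse_at_top_right] .
  then have "((\<lambda>t. flat_exp n t / t) \<longlongrightarrow> 0) (at_right 0)"
    by (rule Lim_transform_eventually)
      (auto simp: eventually_at_filter flat_exp_def exp_minus field_simps)
  moreover have "((\<lambda>t. flat_exp n t / t) \<longlongrightarrow> 0) (at_left 0)"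
    by (rule Lim_transform_eventually[OF tendsto_const])
      (auto simp: eventually_at_filter flat_exp_def)
  ultimately show ?thesis by (simp add: filterlim_split_at)
qed

lemma flat_exp_has_derivative:
  "(flat_exp n has_field_derivative (flat_exp (n + 2) t - n * flat_exp (n + 1) t)) (at t)"
proof (cases t "0::real" rule: linorder_cases)
  case less
  have "((\<lambda>t. 0) has_field_derivative 0) (at t)" by simp
  then have "(flat_exp n has_field_derivative 0) (at t)"
    by (rule has_field_derivative_transform_within_open[of _ _ _ "{..<0}"])
      (use less in \<open>auto simp: flat_exp_def\<close>)
  with less show ?thesis by (simp add: flat_exp_def)
next
  case equal
  then show ?thesis
    using flat_exp_tendsto_0[of n] by (simp add: has_field_derivative_iff flat_exp_def)
next
  case greater
  \<comment> \<open>The power rule yields the exponent \<open>n - 1\<close>; splitting on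
    \<open>n\<close> deals with truncated subtraction at \<open>n = 0\<close>, where the factor
    \<open>n\<close> vanishes anyway.\<close>
  have "((\<lambda>t. inverse t ^ n) has_field_derivative - real n * inverse t ^ (n + 1)) (at t)"
    using DERIV_power[OF DERIV_inverse[of t UNIV], of n] greater
    by (cases n) (auto simp: power2_eq_square algebra_simps)
  from DERIV_mult[OF this DERIV_fun_exp[OF DERIV_minus[OF DERIV_inverse]]] greater
  have "((\<lambda>t. inverse t ^ n * exp (- inverse t)) has_field_derivative
      flat_exp (n + 2) t - n * flat_exp (n + 1) t) (at t)"
    by (simp add: flat_exp_def power2_eq_square algebra_simps)
  then show ?thesis
    by (rule has_field_derivative_transform_within_open[of _ _ _ "{0<..}"])
      (use greater in \<open>auto simp: flat_exp_def\<close>)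
qed

lemma smooth_on_flat_exp: "smooth_on S (flat_exp n)"
proof -
  have "C_k_on k UNIV (flat_exp n)" for k
  proof (induction k arbitrary: n)
    case 0
    show ?case
      using flat_exp_has_derivative[THEN DERIV_isCont]
      by (auto intro: continuous_at_imp_continuous_on)
  next
    case (Suc k)
    show ?case
    proof (rule C_k_on_SucI)
      show "(flat_exp n has_derivative (*) (flat_exp (n + 2) t + (- real n) * flat_exp (n + 1) t)) (at t)"
        for t
        using flat_exp_has_derivative[of n t] by (simp add: has_field_derivative_def)
      show "C_k_on k UNIV (\<lambda>t. (flat_exp (n + 2) t + (- real n) * flat_exp (n + 1) t) * v)" for v
        using Suc by (intro C_k_on_mult C_k_on_add) auto
    qed simp
  qed
  then show ?thesis by (auto simp: smooth_on_def intro: C_k_on_subset)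
qed

text \<open>The squared norm makes the argument of \<open>flat_exp\<close> a polynomial in the
  coordinates, hence smooth at the centre \<open>a\<close> as well, where the norm itself is not
  differentiable.\<close>

definition bump :: "'a::euclidean_space \<Rightarrow> real \<Rightarrow> 'a \<Rightarrow> real" where
  "bump a r x = flat_exp 0 (r\<^sup>2 - (norm (x - a))\<^sup>2)"

lemma bump_pos: "x \<in> ball a r \<Longrightarrow> bump a r x > 0"
  by (simp add: bump_def flat_exp_def dist_norm norm_minus_commute power_strict_mono)

lemma bump_eq_0: "x \<notin> cball a r \<Longrightarrow> r > 0 \<Longrightarrow> bump a r x = 0"
  by (simp add: bump_def flat_exp_def dist_norm norm_minus_commute not_less power_mono)

lemma smooth_on_bump: "smooth_on S (bump a r)"
proof -
  have "smooth_on UNIV (\<lambda>x::'a. r\<^sup>2 + (-1) * ((x + - a) \<bullet> (x + - a)))"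
    by (intro smooth_on_add smooth_on_mult smooth_on_inner smooth_on_const
        smooth_on_linear[OF bounded_linear_ident]) auto
  from smooth_on_compose[OF smooth_on_flat_exp[of UNIV 0] this]
  have "smooth_on UNIV (bump a r)"
    by (simp add: bump_def[abs_def] power2_norm_eq_inner)
  then show ?thesis by (rule smooth_on_subset) simp
qed

section \<open>Tangent vectors and vector fields\<close>

lemma sum_fun_apply: "(\<Sum>i\<in>I. f i) x = (\<Sum>i\<in>I. f i x)"
  by (induction I rule: infinite_finite_induct) auto

locale smooth_atlas =
  fixes A :: "('a::{t2_space,second_countable_topology}, 'n::finite) chart set"
  assumes smooth_manifold: "smooth_manifold A"
begin

lemma chart_homeomorphism:
  "c \<in> A \<Longrightarrow> homeomorphism (fst c) (snd c ` fst c) (snd c) (chart_inv c)"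
  and open_chart_domain: "c \<in> A \<Longrightarrow> open (fst c)"
  and open_chart_range: "c \<in> A \<Longrightarrow> open (snd c ` fst c)"
  using smooth_manifold by (auto simp: smooth_manifold_def is_chart_def)

lemma chart_inv_chart [simp]: "c \<in> A \<Longrightarrow> p \<in> fst c \<Longrightarrow> chart_inv c (snd c p) = p"
  using chart_homeomorphism by (auto simp: homeomorphism_def)

lemma chart_inv_in: "c \<in> A \<Longrightarrow> U \<subseteq> fst c \<Longrightarrow> x \<in> snd c ` U \<Longrightarrow> chart_inv c x \<in> U"
  by (auto simp: subset_iff)

lemma ex_chart: "\<exists>c\<in>A. p \<in> fst c"
  using smooth_manifold by (auto simp: smooth_manifold_def)

lemma open_chart_image:
  assumes "c \<in> A" "open U" "U \<subseteq> fst c"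
  shows "open (snd c ` U)"
proof -
  have "snd c ` U = snd c ` fst c \<inter> chart_inv c -` U"
    using assms by (auto simp: image_iff subset_iff)
  moreover have "continuous_on (snd c ` fst c) (chart_inv c)"
    using chart_homeomorphism[OF assms(1)] by (simp add: homeomorphism_def)
  ultimately show ?thesis
    using continuous_open_preimage open_chart_range[OF assms(1)] assms(2) by metis
qed

lemma smooth_transition:
  "c \<in> A \<Longrightarrow> d \<in> A \<Longrightarrow> smooth_on (snd c ` (fst c \<inter> fst d)) (snd d \<circ> chart_inv c)"
  using smooth_manifold by (auto simp: smooth_manifold_def)

lemma open_overlap: "c \<in> A \<Longrightarrow> d \<in> A \<Longrightarrow> open (snd c ` (fst c \<inter> fst d))"
  by (intro open_chart_image open_Int open_chart_domain) auto

lemma transition_has_derivative: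
  assumes "c \<in> A" "d \<in> A" "p \<in> fst c" "p \<in> fst d"
  shows "((snd d \<circ> chart_inv c) has_derivative
    frechet_derivative (snd d \<circ> chart_inv c) (at (snd c p))) (at (snd c p))"
  using assms by (intro smooth_on_has_derivative[OF smooth_transition]) auto

text \<open>Chain rule: near \<open>snd c p\<close>, on the image of the overlap of \<open>c\<close>
  and \<open>d\<close>, passing from \<open>c\<close> through \<open>d\<close> to \<open>e\<close>
  is the direct transition.\<close>

lemma transition_cocycle:
  assumes "c \<in> A" "d \<in> A" "e \<in> A" "p \<in> fst c" "p \<in> fst d" "p \<in> fst e"
  shows "frechet_derivative (snd e \<circ> chart_inv d) (at (snd d p))
      (frechet_derivative (snd d \<circ> chart_inv c) (at (snd c p)) w) =
    frechet_derivative (snd e \<circ> chart_inv c) (at (snd c p)) w"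
proof -
  let ?D1 = "frechet_derivative (snd d \<circ> chart_inv c) (at (snd c p))"
  let ?D2 = "frechet_derivative (snd e \<circ> chart_inv d) (at (snd d p))"
  have "((snd e \<circ> chart_inv d \<circ> (snd d \<circ> chart_inv c)) has_derivative (?D2 \<circ> ?D1)) (at (snd c p))"
    using diff_chain_at[OF transition_has_derivative[of c d p], of "snd e \<circ> chart_inv d" ?D2]
      transition_has_derivative[of d e p] assms
    by simp
  then have "((snd e \<circ> chart_inv c) has_derivative (?D2 \<circ> ?D1)) (at (snd c p))"
    by (rule has_derivative_transform_within_open[OF _ open_overlap[OF assms(1,2)]])
      (use assms in auto)
  then show ?thesis by (metis comp_apply frechet_derivative_at)
qed

lemma transition_refl:
  assumes "c \<in> A" "p \<in> fst c"
  shows "frechet_derivative (snd c \<circ> chart_inv c) (at (snd c p)) w = w"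
proof -
  have "((snd c \<circ> chart_inv c) has_derivative (\<lambda>w. w)) (at (snd c p))"
    by (rule has_derivative_transform_within_open[OF has_derivative_ident open_chart_range[OF assms(1)]])
      (use assms in auto)
  then show ?thesis by (metis frechet_derivative_at)
qed

text \<open>On \<open>tangent_space A p\<close> the map \<open>v \<mapsto> v c\<close> has this
  inverse: one coordinate vector determines the whole family by the Jacobians. It identifies the
  tangent space with the coordinate space.\<close>

definition tangent_of :: "('a, 'n) chart \<Rightarrow> 'a \<Rightarrow> real ^ 'n \<Rightarrow> ('a, 'n) tangent" where
  "tangent_of c p w = (\<lambda>d. if d \<in> A \<and> p \<in> fst d
     then frechet_derivative (snd d \<circ> chart_inv c) (at (snd c p)) w else 0)"

lemma tangent_of_in: "c \<in> A \<Longrightarrow> p \<in> fst c \<Longrightarrow> tangent_of c p w \<in> tangent_space A p"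
  by (auto simp: tangent_space_def tangent_of_def transition_cocycle)

lemma tangent_of_chart [simp]: "c \<in> A \<Longrightarrow> p \<in> fst c \<Longrightarrow> tangent_of c p w c = w"
  by (simp add: tangent_of_def transition_refl)

lemma tangent_of_coordinates:
  assumes "c \<in> A" "p \<in> fst c" "v \<in> tangent_space A p"
  shows "tangent_of c p (v c) = v"
proof
  fix d
  show "tangent_of c p (v c) d = v d"
  proof (cases "d \<in> A \<and> p \<in> fst d")
    case True
    then have "v d = frechet_derivative (snd d \<circ> chart_inv c) (at (snd c p)) (v c)"
      using assms unfolding tangent_space_def by blast
    with True show ?thesis by (simp only: tangent_of_def if_True simp_thms)
  next
    case False
    then have "v d = 0" using assms(3) unfolding tangent_space_def by blast
    with False show ?thesis by (auto simp: tangent_of_def)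
  qed
qed

lemma linear_tangent_of:
  assumes "c \<in> A" "p \<in> fst c"
  shows "linear (tangent_of c p)"
proof -
  have "linear (frechet_derivative (snd d \<circ> chart_inv c) (at (snd c p)))" if "d \<in> A" "p \<in> fst d" for d
    using transition_has_derivative[of c d p] assms that has_derivative_linear by blast
  then show ?thesis
    by (intro linearI ext) (auto simp: tangent_of_def linear_add linear_scale scaleR_fun_def)
qed

lemma subspace_tangent_space: "subspace (tangent_space A p)"
proof -
  obtain c where c: "c \<in> A" "p \<in> fst c" using ex_chart by blast
  then have "tangent_space A p = range (tangent_of c p)"
    using tangent_of_in tangent_of_coordinates by (metis (no_types, lifting) equalityI image_subset_iff rangeI subsetI)
  then show ?thesis using linear_subspace_image[OF linear_tangent_of[OF c] subspace_UNIV] by simp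
qed

lemmas tangent_space_0 [simp] = subspace_0[OF subspace_tangent_space]
lemmas tangent_space_add [simp] = subspace_add[OF subspace_tangent_space]
lemmas tangent_space_scale [simp] = subspace_scale[OF subspace_tangent_space]
lemmas tangent_space_sum = subspace_sum[OF subspace_tangent_space]

section \<open>Smooth functions, vector fields and 1-forms\<close>

lemma smooth_functionsD:
  "f \<in> smooth_functions A \<Longrightarrow> c \<in> A \<Longrightarrow> smooth_on (snd c ` fst c) (\<lambda>x. f (chart_inv c x))"
  by (auto simp: smooth_functions_def comp_def)

lemma smooth_functions_const: "(\<lambda>p. a) \<in> smooth_functions A"
  by (simp add: smooth_functions_def comp_def)

lemma smooth_functions_add:
  "f \<in> smooth_functions A \<Longrightarrow> h \<in> smooth_functions A \<Longrightarrow> (\<lambda>p. f p + h p) \<in> smooth_functions A"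
  by (simp add: smooth_functions_def comp_def smooth_on_add open_chart_range)

lemma smooth_functions_mult:
  "f \<in> smooth_functions A \<Longrightarrow> h \<in> smooth_functions A \<Longrightarrow> (\<lambda>p. f p * h p) \<in> smooth_functions A"
  by (simp add: smooth_functions_def comp_def smooth_on_mult open_chart_range)

lemma vector_fieldsD: "X \<in> vector_fields A \<Longrightarrow> X p \<in> tangent_space A p"
  by (simp add: vector_fields_def)

lemma vector_fields_0: "0 \<in> vector_fields A"
  by (simp add: vector_fields_def)

lemma vector_fields_add: "X \<in> vector_fields A \<Longrightarrow> Y \<in> vector_fields A \<Longrightarrow> X + Y \<in> vector_fields A"
  by (simp add: vector_fields_def smooth_on_add open_chart_range)

lemma vector_fields_scale:
  "f \<in> smooth_functions A \<Longrightarrow> X \<in> vector_fields A \<Longrightarrow> (\<lambda>p. f p *\<^sub>R X p) \<in> vector_fields A"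
  by (auto simp: vector_fields_def smooth_functions_def comp_def scaleR_fun_def[of _ "X _" for X]
      intro!: smooth_on_scaleR open_chart_range tangent_space_scale[unfolded scaleR_fun_def])

lemma vector_fields_scaleR: "X \<in> vector_fields A \<Longrightarrow> a *\<^sub>R X \<in> vector_fields A"
  using vector_fields_scale[OF smooth_functions_const, of X a] by (simp add: scaleR_fun_def[of a X])

lemma one_formsD: "\<xi> \<in> one_forms A \<Longrightarrow> \<xi> p \<in> cotangent_space A p"
  by (simp add: one_forms_def)

lemma pairing_smooth: "\<xi> \<in> one_forms A \<Longrightarrow> X \<in> vector_fields A \<Longrightarrow> pairing \<xi> X \<in> smooth_functions A"
  by (simp add: one_forms_def)

lemma cotangent_space_0: "0 \<in> cotangent_space A p"
  by (simp add: cotangent_space_def)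

lemma cotangent_sum:
  assumes "\<omega> \<in> cotangent_space A p" "\<And>i. i \<in> I \<Longrightarrow> v i \<in> tangent_space A p"
  shows "\<omega> (\<Sum>i\<in>I. a i *\<^sub>R v i) = (\<Sum>i\<in>I. a i * \<omega> (v i))"
proof -
  have lin: "\<omega> (b *\<^sub>R x + d *\<^sub>R y) = b * \<omega> x + d * \<omega> y"
    if "x \<in> tangent_space A p" "y \<in> tangent_space A p" for b d x y
    using assms(1) that by (simp add: cotangent_space_def)
  have zero: "\<omega> 0 = 0" using lin[of 0 0 0 0] by simp
  from assms(2) show ?thesis
  proof (induction I rule: infinite_finite_induct)
    case (insert i I)
    then have "\<omega> (a i *\<^sub>R v i + 1 *\<^sub>R (\<Sum>i\<in>I. a i *\<^sub>R v i)) = a i * \<omega> (v i) + 1 * \<omega> (\<Sum>i\<in>I. a i *\<^sub>R v i)"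
      by (intro lin tangent_space_sum tangent_space_scale) auto
    with insert show ?case by (simp only: sum.insert scaleR_one mult_1 insert_iff simp_thms)
  qed (auto simp: zero)
qed

text \<open>Coordinate fields live on the chart domain only; a cutoff supported inside the domain
  makes them global. One \<open>\<phi>\<close> and one \<open>U\<close> serve all \<open>w\<close>,
  so that the axis vectors yield global fields that form a frame over \<open>U\<close>.\<close>

lemma bump_field:
  assumes c: "c \<in> A" and p: "p \<in> fst c"
  obtains \<phi> U where "open U" "p \<in> U" "U \<subseteq> fst c" "\<And>q. q \<in> U \<Longrightarrow> \<phi> q > (0::real)"
    "\<And>w. (\<lambda>q. \<phi> q *\<^sub>R tangent_of c q w) \<in> vector_fields A"
proof -
  obtain r where r: "r > 0" "cball (snd c p) r \<subseteq> snd c ` fst c"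
    using open_chart_range[OF c] p by (meson image_eqI open_contains_cball)
  define \<phi> where "\<phi> q = (if q \<in> fst c then bump (snd c p) r (snd c q) else 0)" for q
  define K where "K = chart_inv c ` cball (snd c p) r"
  define U where "U = fst c \<inter> snd c -` ball (snd c p) r"
  have cont: "continuous_on (fst c) (snd c)" "continuous_on (snd c ` fst c) (chart_inv c)"
    using chart_homeomorphism[OF c] by (auto simp: homeomorphism_def)
  \<comment> \<open>The Hausdorff property enters here: the compact set \<open>K\<close> is closed
    in the whole manifold, so off \<open>K\<close> the cutoff vanishes on an open set.\<close>
  have "closed K" unfolding K_def
    by (intro compact_imp_closed compact_continuous_image compact_cball continuous_on_subset[OF cont(2) r(2)])
  have K: "K \<subseteq> fst c" using r(2) c by (force simp: K_def subset_iff)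
  have \<phi>_0: "\<phi> q = 0" if "q \<notin> K" for q
  proof (cases "q \<in> fst c")
    case True
    then have "snd c q \<notin> cball (snd c p) r" using that c unfolding K_def by (metis chart_inv_chart image_eqI)
    then show ?thesis using r(1) by (simp add: \<phi>_def bump_eq_0)
  qed (simp add: \<phi>_def)
  show thesis
  proof (rule that)
    show "open U" unfolding U_def
      using continuous_open_preimage[OF cont(1) open_chart_domain[OF c] open_ball] .
    show "p \<in> U" "U \<subseteq> fst c" using p r(1) by (auto simp: U_def)
    show "\<phi> q > 0" if "q \<in> U" for q using that by (simp add: U_def \<phi>_def bump_pos)
    show "(\<lambda>q. \<phi> q *\<^sub>R tangent_of c q w) \<in> vector_fields A" for w
      unfolding vector_fields_def
    proof (intro CollectI conjI allI ballI)
      show "\<phi> q *\<^sub>R tangent_of c q w \<in> tangent_space A q" for q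
        by (cases "q \<in> fst c") (simp_all add: tangent_of_in c \<phi>_def)
      fix d assume d: "d \<in> A"
      let ?s = "\<lambda>x. (\<phi> (chart_inv d x) *\<^sub>R tangent_of c (chart_inv d x) w) d"
      let ?t = "snd c \<circ> chart_inv d"
      show "smooth_on (snd d ` fst d) ?s"
      proof (rule smooth_on_local)
        fix x assume "x \<in> snd d ` fst d"
        then obtain q where q: "q \<in> fst d" "x = snd d q" by auto
        show "\<exists>T. open T \<and> x \<in> T \<and> smooth_on T ?s"
        \<comment> \<open>Inside the domain of \<open>c\<close> the \<open>d\<close>-coordinates of
          the field are the bump times a Jacobian, both composed with the transition map. Outside
          it, \<open>q\<close> has a neighbourhood avoiding \<open>K\<close>, on which the field is
          zero.\<close>
        proof (cases "q \<in> fst c")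
          case True
          let ?T = "snd d ` (fst d \<inter> fst c)"
          have opn: "open ?T" using open_overlap[OF d c] .
          have t: "?t ` ?T \<subseteq> snd c ` (fst c \<inter> fst d)" using c d by auto
          have "smooth_on ?T (\<lambda>x. bump (snd c p) r (?t x) *\<^sub>R
              frechet_derivative (snd d \<circ> chart_inv c) (at (?t x)) w)"
            using smooth_on_compose[OF smooth_on_bump smooth_transition[OF d c] opn open_UNIV]
              smooth_on_compose[OF smooth_on_frechet_derivative[OF smooth_transition[OF c d]]
                smooth_transition[OF d c] opn open_overlap[OF c d] t]
            by (intro smooth_on_scaleR[OF opn]) auto
          then have "smooth_on ?T ?s"
            using d by (rule_tac iffD1[OF smooth_on_cong[OF opn]])
              (auto simp: \<phi>_def tangent_of_def scaleR_fun_def)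
          with opn True q show ?thesis by blast
        next
          case False
          let ?T = "snd d ` (fst d - K)"
          have opn: "open ?T"
            using d \<open>closed K\<close> by (intro open_chart_image open_Diff open_chart_domain) auto
          have "smooth_on ?T ?s"
            using d by (rule_tac iffD1[OF smooth_on_cong[OF opn] smooth_on_const[of _ 0]]) (auto simp: \<phi>_0)
          with opn False K q show ?thesis by blast
        qed
      qed
    qed
  qed
qed

text \<open>A cut-off coordinate field has the right direction at \<open>p\<close>; dividing its
  coordinates by \<open>\<phi> p > 0\<close> corrects the length. Identities between sections thus
  become pointwise identities.\<close>

lemma vector_field_through:
  assumes "v \<in> tangent_space A p"
  obtains X where "X \<in> vector_fields A" "X p = v"
proof -
  obtain c where c: "c \<in> A" "p \<in> fst c" using ex_chart by blast
  obtain \<phi> U where "open U" and U: "p \<in> U" and "U \<subseteq> fst c"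
    and \<phi>: "\<And>q. q \<in> U \<Longrightarrow> \<phi> q > (0::real)"
    "\<And>w. (\<lambda>q. \<phi> q *\<^sub>R tangent_of c q w) \<in> vector_fields A"
    by (rule bump_field[OF c]) blast
  show thesis
  proof (rule that[OF \<phi>(2)])
    show "\<phi> p *\<^sub>R tangent_of c p ((1 / \<phi> p) *\<^sub>R v c) = v"
      using \<phi>(1)[OF U] c assms
      by (simp add: linear_scale[OF linear_tangent_of] tangent_of_coordinates)
  qed
qed

text \<open>Positive dimension is used here: the index type is inhabited, so an axis vector
  exists.\<close>

lemma ex_nonzero_tangent: "\<exists>v\<in>tangent_space A p. v \<noteq> 0"
proof -
  obtain c where c: "c \<in> A" "p \<in> fst c" using ex_chart by blast
  then have "tangent_of c p (axis undefined 1) c \<noteq> 0" by (simp add: axis_eq_0_iff)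
  then have "tangent_of c p (axis undefined 1) \<noteq> 0" by (metis zero_fun_apply)
  then show ?thesis using tangent_of_in[OF c] by blast
qed

lemma cotangent_eqI:
  assumes "\<omega> \<in> cotangent_space A p" "\<eta> \<in> cotangent_space A p"
    "\<And>v. v \<in> tangent_space A p \<Longrightarrow> \<omega> v = \<eta> v"
  shows "\<omega> = \<eta>"
  using assms by (auto simp: cotangent_space_def fun_eq_iff) metis

lemma one_form_eqI:
  assumes "\<xi> \<in> one_forms A" "\<eta> \<in> one_forms A"
    "\<And>X. X \<in> vector_fields A \<Longrightarrow> pairing \<xi> X = pairing \<eta> X"
  shows "\<xi> = \<eta>"
proof
  fix p show "\<xi> p = \<eta> p"
  proof (rule cotangent_eqI[OF one_formsD one_formsD])
    fix v assume "v \<in> tangent_space A p"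
    then obtain X where "X \<in> vector_fields A" "X p = v" by (rule vector_field_through)
    with fun_cong[OF assms(3)[of X], of p] show "\<xi> p v = \<eta> p v" by (simp add: pairing_def)
  qed (use assms in auto)
qed

end

section \<open>The musical isomorphisms\<close>

locale metric_atlas = smooth_atlas A
  for A :: "('a::{t2_space,second_countable_topology}, 'n::finite) chart set" +
  fixes g :: "('a, 'n) metric"
  assumes metric: "bundle_metric A (tangent_space A) (vector_fields A) g"
begin

lemma g_sym: "u \<in> tangent_space A p \<Longrightarrow> v \<in> tangent_space A p \<Longrightarrow> g p u v = g p v u"
  using metric[unfolded bundle_metric_def, THEN conjunct1] by simp

lemma g_lin:
  "u \<in> tangent_space A p \<Longrightarrow> v \<in> tangent_space A p \<Longrightarrow> w \<in> tangent_space A p \<Longrightarrow>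
    g p (a *\<^sub>R u + b *\<^sub>R v) w = a * g p u w + b * g p v w"
  using metric[unfolded bundle_metric_def, THEN conjunct2, THEN conjunct1] by simp

lemma g_add:
  "u \<in> tangent_space A p \<Longrightarrow> v \<in> tangent_space A p \<Longrightarrow> w \<in> tangent_space A p \<Longrightarrow>
    g p (u + v) w = g p u w + g p v w"
  using g_lin[of u p v w 1 1] by simp

lemma g_scale:
  "u \<in> tangent_space A p \<Longrightarrow> w \<in> tangent_space A p \<Longrightarrow> g p (a *\<^sub>R u) w = a * g p u w"
  using g_lin[of u p u w a 0] by simp

lemma g_nondegenerate:
  "u \<in> tangent_space A p \<Longrightarrow> (\<And>v. v \<in> tangent_space A p \<Longrightarrow> g p u v = 0) \<Longrightarrow> u = 0"
  using metric[unfolded bundle_metric_def, THEN conjunct2, THEN conjunct2, THEN conjunct1] by simp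

lemma g_smooth:
  "X \<in> vector_fields A \<Longrightarrow> Y \<in> vector_fields A \<Longrightarrow> (\<lambda>p. g p (X p) (Y p)) \<in> smooth_functions A"
  using metric by (simp add: bundle_metric_def on_sections_def)

lemma flat_apply: "v \<in> tangent_space A p \<Longrightarrow> flat A g X p v = g p (X p) v"
  by (simp add: flat_def)

text \<open>Linearity in the second slot follows from the first by symmetry. Having the covector of
  a single tangent vector makes covector facts available pointwise, before any smooth field is
  known.\<close>

lemma flat_at_in:
  assumes "u \<in> tangent_space A p"
  shows "(\<lambda>v. if v \<in> tangent_space A p then g p u v else 0) \<in> cotangent_space A p"
proof -
  have "g p u (a *\<^sub>R v + b *\<^sub>R w) = a * g p u v + b * g p u w"
    if "v \<in> tangent_space A p" "w \<in> tangent_space A p" for a b v w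
    using assms that g_lin[of v p w u a b] by (simp add: g_sym[of u])
  then show ?thesis by (simp add: cotangent_space_def)
qed

lemma flat_in: "X \<in> vector_fields A \<Longrightarrow> flat A g X \<in> one_forms A"
  using flat_at_in[OF vector_fieldsD] g_smooth
  by (auto simp: one_forms_def flat_def pairing_def vector_fieldsD)

lemma flat_add:
  "X \<in> vector_fields A \<Longrightarrow> Y \<in> vector_fields A \<Longrightarrow> flat A g (X + Y) = flat A g X + flat A g Y"
  by (intro ext) (simp add: flat_def vector_fieldsD g_add)

lemma flat_scale:
  "X \<in> vector_fields A \<Longrightarrow> flat A g (\<lambda>p. f p *\<^sub>R X p) = (\<lambda>p. f p *\<^sub>R flat A g X p)"
  by (intro ext) (simp add: flat_def vector_fieldsD g_scale scaleR_fun_def[of _ "\<lambda>v. if _ v then _ v else _"])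

lemma inj_on_flat: "inj_on (flat A g) (vector_fields A)"
proof (rule inj_onI, rule ext)
  fix X Y p assume X: "X \<in> vector_fields A" "Y \<in> vector_fields A" and eq: "flat A g X = flat A g Y"
  \<comment> \<open>The difference is written as a sum with a multiple so that the addition and
    scaling rules for \<open>g\<close> suffice.\<close>
  have "X p + (-1) *\<^sub>R Y p = 0"
  proof (rule g_nondegenerate)
    fix v assume v: "v \<in> tangent_space A p"
    then have "g p (X p) v = g p (Y p) v" using eq by (metis flat_apply)
    then show "g p (X p + (-1) *\<^sub>R Y p) v = 0"
      using X v by (simp only: g_add g_scale vector_fieldsD tangent_space_scale)
  qed (use X vector_fieldsD in \<open>intro tangent_space_add tangent_space_scale, auto\<close>)
  then show "X p = Y p" by simp
qed

text \<open>In a frame \<open>E\<close> over \<open>U\<close> the equation g(Y, -) = \<xi> is a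
  linear system with the Gram matrix \<open>G\<close> as coefficients and the values of \<xi> on the
  frame as right-hand side \<open>b\<close>. Cramer's rule writes its solution as quotients of
  determinants of smooth entries.\<close>

lemma flat_surj_local:
  assumes \<xi>: "\<xi> \<in> one_forms A" and c: "c \<in> A" "p \<in> fst c"
  obtains U Y where "open U" "p \<in> U" "U \<subseteq> fst c"
    "\<And>q. q \<in> U \<Longrightarrow> Y q \<in> tangent_space A q"
    "\<And>q v. q \<in> U \<Longrightarrow> v \<in> tangent_space A q \<Longrightarrow> g q (Y q) v = \<xi> q v"
    "smooth_on (snd c ` U) (\<lambda>x. Y (chart_inv c x) c)"
proof -
  obtain \<phi> U where U: "open U" "p \<in> U" "U \<subseteq> fst c" "\<And>q. q \<in> U \<Longrightarrow> \<phi> q > (0::real)"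
    and E_in': "\<And>w. (\<lambda>q. \<phi> q *\<^sub>R tangent_of c q w) \<in> vector_fields A"
    by (rule bump_field[OF c]) blast
  \<comment> \<open>The frame fields must be global, because \<open>g\<close> and \<xi> are only
    known to be smooth when evaluated on globally defined smooth fields.\<close>
  define E where "E i = (\<lambda>q. \<phi> q *\<^sub>R tangent_of c q (axis i 1))" for i
  have E_in: "E i \<in> vector_fields A" for i using E_in' by (simp add: E_def)
  have E_tan: "E i q \<in> tangent_space A q" for i q using E_in by (rule vector_fieldsD)
  have E_comb: "(\<Sum>i\<in>UNIV. a $ i *\<^sub>R E i q) = tangent_of c q (\<phi> q *\<^sub>R a)" if "q \<in> U" for q a
  proof -
    have q: "q \<in> fst c" using that U by auto
    have "tangent_of c q (\<phi> q *\<^sub>R a) = tangent_of c q (\<Sum>i\<in>UNIV. (a $ i * \<phi> q) *\<^sub>R axis i 1)"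
      by (rule arg_cong[of _ _ "tangent_of c q"]) (simp add: vec_eq_iff axis_def mult.commute if_distrib cong: if_cong)
    also have "\<dots> = (\<Sum>i\<in>UNIV. a $ i *\<^sub>R E i q)"
      using linear_tangent_of[OF c(1) q] by (simp add: E_def linear_sum linear_scale)
    finally show ?thesis by simp
  qed
  \<comment> \<open>Over \<open>U\<close> the frame spans, so covectors may be compared on the frame
    alone.\<close>
  have ext: "\<omega> = \<eta>" if "q \<in> U" and co: "\<omega> \<in> cotangent_space A q" "\<eta> \<in> cotangent_space A q"
    and eq: "\<And>i. \<omega> (E i q) = \<eta> (E i q)" for \<omega> \<eta> q
  proof (rule cotangent_eqI[OF co])
    fix v assume v: "v \<in> tangent_space A q"
    \<comment> \<open>The frame carries the factor \<open>\<phi> q\<close>, so the coefficients are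
      the chart coordinates divided by it.\<close>
    have "v = (\<Sum>i\<in>UNIV. ((1 / \<phi> q) *\<^sub>R v c) $ i *\<^sub>R E i q)"
      using U(3) U(4)[OF \<open>q \<in> U\<close>] c v \<open>q \<in> U\<close>
      by (subst E_comb) (auto simp: tangent_of_coordinates subset_iff)
    then show "\<omega> v = \<eta> v"
      using cotangent_sum[OF co(1), of UNIV "\<lambda>i. E i q"] cotangent_sum[OF co(2), of UNIV "\<lambda>i. E i q"]
        E_tan eq by (metis (no_types, lifting) sum.cong)
  qed
  define G where "G q = (\<chi> i j. g q (E j q) (E i q))" for q
  define b where "b q = (\<chi> i. \<xi> q (E i q))" for q
  \<comment> \<open>Cramer's rule: the numerator has column \<open>k\<close> of \<open>G q\<close>
    replaced by \<open>b q\<close>.\<close>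
  define a where "a q = (\<chi> k. det (\<chi> i j. if j = k then b q $ i else G q $ i $ j) / det (G q))" for q
  define Y where "Y q = (\<Sum>k\<in>UNIV. a q $ k *\<^sub>R E k q)" for q
  have g_comb: "g q (\<Sum>k\<in>UNIV. x $ k *\<^sub>R E k q) (E i q) = (G q *v x) $ i" for q x i
  proof -
    have "g q (\<Sum>k\<in>UNIV. x $ k *\<^sub>R E k q) (E i q) = g q (E i q) (\<Sum>k\<in>UNIV. x $ k *\<^sub>R E k q)"
      by (intro g_sym tangent_space_sum tangent_space_scale E_tan)
    also have "\<dots> = (\<Sum>k\<in>UNIV. x $ k * g q (E i q) (E k q))"
      using cotangent_sum[OF flat_at_in[OF E_tan[of i q]], of UNIV "\<lambda>k. E k q" "\<lambda>k. x $ k"]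
      by (simp add: E_tan tangent_space_sum)
    also have "\<dots> = (G q *v x) $ i"
      by (simp add: matrix_vector_mult_def G_def g_sym[OF E_tan E_tan, of q i] mult.commute)
    finally show ?thesis .
  qed
  have comb_in: "(\<Sum>k\<in>UNIV. x $ k *\<^sub>R E k q) \<in> tangent_space A q" for x q
    by (intro tangent_space_sum tangent_space_scale E_tan)
  have det: "det (G q) \<noteq> 0" if "q \<in> U" for q
  proof -
    have "x = 0" if x: "G q *v x = 0" for x
    proof -
      let ?y = "\<Sum>k\<in>UNIV. x $ k *\<^sub>R E k q"
      \<comment> \<open>A kernel vector of the Gram matrix gives a combination \<open>?y\<close>
        orthogonal to the frame, hence to every tangent vector. Nondegeneracy makes it zero, and
        \<open>\<phi> q > 0\<close> then forces \<open>x = 0\<close>.\<close>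
      have "(\<lambda>v. if v \<in> tangent_space A q then g q ?y v else 0) = 0"
        using \<open>q \<in> U\<close> by (rule ext[OF _ flat_at_in[OF comb_in] cotangent_space_0]) (simp add: E_tan g_comb x)
      then have "g q ?y v = 0" if "v \<in> tangent_space A q" for v
        using that by (auto dest: fun_cong[of _ _ v])
      then have "?y = 0" by (rule g_nondegenerate[OF comb_in])
      then have "tangent_of c q (\<phi> q *\<^sub>R x) c = 0" using E_comb[OF \<open>q \<in> U\<close>] by simp
      moreover have "q \<in> fst c" using U(3) \<open>q \<in> U\<close> by auto
      ultimately show ?thesis using U(4)[OF \<open>q \<in> U\<close>] c by simp
    qed
    then show ?thesis
      using matrix_left_invertible_ker[of "G q"] invertible_det_nz[of "G q"]
      by (metis invertible_left_inverse)
  qed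
  show thesis
  proof (rule that[OF U(1-3)])
    show Y_in: "Y q \<in> tangent_space A q" for q by (simp add: Y_def comb_in)
    show "g q (Y q) v = \<xi> q v" if q: "q \<in> U" and v: "v \<in> tangent_space A q" for q v
    proof -
      have "G q *v a q = b q"
        using cramer[OF det[OF q], of "a q" "b q"] by (simp only: a_def simp_thms)
      then have "(\<lambda>v. if v \<in> tangent_space A q then g q (Y q) v else 0) = \<xi> q"
        by (intro ext[OF q flat_at_in[OF Y_in] one_formsD[OF \<xi>]]) (simp add: E_tan g_comb Y_def b_def)
      from fun_cong[OF this, of v] v show ?thesis by simp
    qed
    have opn: "open (snd c ` U)" using open_chart_image[OF c(1) U(1,3)] .
    have sub: "snd c ` U \<subseteq> snd c ` fst c" using U(3) by auto
    have smG: "smooth_on (snd c ` U) (\<lambda>x. G (chart_inv c x) $ i $ j)" for i j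
      using smooth_on_subset[OF smooth_functionsD[OF g_smooth[OF E_in E_in] c(1)] sub]
      by (simp add: G_def)
    have smb: "smooth_on (snd c ` U) (\<lambda>x. b (chart_inv c x) $ i)" for i
      using smooth_on_subset[OF smooth_functionsD[OF pairing_smooth[OF \<xi> E_in] c(1)] sub]
      by (simp add: pairing_def b_def)
    have sma: "smooth_on (snd c ` U) (\<lambda>x. a (chart_inv c x) $ k)" for k
      unfolding a_def vec_lambda_beta
    proof (intro smooth_on_divide smooth_on_det opn smG)
      show "det (G (chart_inv c x)) \<noteq> 0" if "x \<in> snd c ` U" for x
        using det chart_inv_in[OF c(1) U(3) that] .
      show "smooth_on (snd c ` U) (\<lambda>x. (\<chi> i j. if j = k
          then b (chart_inv c x) $ i else G (chart_inv c x) $ i $ j) $ i $ j)" for i j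
        using smb smG by (cases "j = k") simp_all
    qed
    have smE: "smooth_on (snd c ` U) (\<lambda>x. E k (chart_inv c x) c)" for k
      using E_in[of k] c(1) sub by (auto simp: vector_fields_def intro: smooth_on_subset)
    have "(\<lambda>x. Y (chart_inv c x) c) = (\<lambda>x. \<Sum>k\<in>UNIV. a (chart_inv c x) $ k *\<^sub>R E k (chart_inv c x) c)"
      unfolding Y_def by (subst sum_fun_apply) (simp add: scaleR_fun_def)
    then show "smooth_on (snd c ` U) (\<lambda>x. Y (chart_inv c x) c)"
      by (simp only:) (intro smooth_on_sum smooth_on_scaleR opn sma smE)
  qed
qed

text \<open>Nondegeneracy makes the solution at each point unique, so the local smooth solutions
  agree where they meet and glue to a global field.\<close>

lemma flat_surj:
  assumes \<xi>: "\<xi> \<in> one_forms A"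
  shows "\<xi> \<in> flat A g ` vector_fields A"
proof -
  define P where "P q u \<longleftrightarrow> u \<in> tangent_space A q \<and> (\<forall>v\<in>tangent_space A q. g q u v = \<xi> q v)" for q u
  have P_unique: "u = u'" if "P q u" "P q u'" for q u u'
  proof -
    have "u + (-1) *\<^sub>R u' = 0"
    proof (rule g_nondegenerate)
      show "u + (-1) *\<^sub>R u' \<in> tangent_space A q"
        using that unfolding P_def by (intro tangent_space_add tangent_space_scale) auto
      show "g q (u + (-1) *\<^sub>R u') v = 0" if "v \<in> tangent_space A q" for v
        using \<open>P q u\<close> \<open>P q u'\<close> that unfolding P_def
        by (simp only: g_add g_scale tangent_space_scale)
    qed
    then show ?thesis by simp
  qed
  \<comment> \<open>A pointwise choice suffices: by uniqueness it coincides with every local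
    solution and inherits its smoothness.\<close>
  define X where "X q = (SOME u. P q u)" for q
  have P_X: "P q (X q)" for q
  proof -
    obtain c where c: "c \<in> A" "q \<in> fst c" using ex_chart by blast
    have "\<exists>u. P q u" by (rule flat_surj_local[OF \<xi> c]) (unfold P_def, blast)
    then show ?thesis unfolding X_def by (rule someI_ex)
  qed
  have "X \<in> vector_fields A"
    unfolding vector_fields_def
  proof (intro CollectI conjI allI ballI)
    show "X q \<in> tangent_space A q" for q using P_X by (simp add: P_def)
    fix c assume c: "c \<in> A"
    show "smooth_on (snd c ` fst c) (\<lambda>x. X (chart_inv c x) c)"
    proof (rule smooth_on_local)
      fix x assume "x \<in> snd c ` fst c"
      then obtain p where p: "p \<in> fst c" "x = snd c p" by auto
      obtain U Y where U: "open U" "p \<in> U" "U \<subseteq> fst c"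
        "\<And>q. q \<in> U \<Longrightarrow> Y q \<in> tangent_space A q"
        "\<And>q v. q \<in> U \<Longrightarrow> v \<in> tangent_space A q \<Longrightarrow> g q (Y q) v = \<xi> q v"
        "smooth_on (snd c ` U) (\<lambda>x. Y (chart_inv c x) c)"
        by (rule flat_surj_local[OF \<xi> c p(1)]) blast
      have "X q = Y q" if "q \<in> U" for q
        using P_unique[OF P_X] U(4,5) that by (simp add: P_def)
      then have "smooth_on (snd c ` U) (\<lambda>x. X (chart_inv c x) c)"
        using U(6) chart_inv_in[OF c U(3)]
        by (rule_tac iffD1[OF smooth_on_cong[OF open_chart_image[OF c U(1,3)]]]) auto
      with open_chart_image[OF c U(1,3)] U(2) p(2)
      show "\<exists>T. open T \<and> x \<in> T \<and> smooth_on T (\<lambda>x. X (chart_inv c x) c)" by blast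
    qed
  qed
  moreover have "flat A g X = \<xi>"
  proof
    show "flat A g X q = \<xi> q" for q
      using P_X[of q] flat_at_in[of "X q" q] one_formsD[OF \<xi>, of q]
      by (intro cotangent_eqI) (auto simp: P_def flat_def)
  qed
  ultimately show ?thesis by blast
qed

lemma sharp_in: "\<xi> \<in> one_forms A \<Longrightarrow> sharp A g \<xi> \<in> vector_fields A"
  unfolding sharp_def by (intro inv_into_into flat_surj)

lemma flat_sharp: "\<xi> \<in> one_forms A \<Longrightarrow> flat A g (sharp A g \<xi>) = \<xi>"
  unfolding sharp_def by (rule f_inv_into_f[OF flat_surj])

lemma sharp_flat: "X \<in> vector_fields A \<Longrightarrow> sharp A g (flat A g X) = X"
  unfolding sharp_def by (intro inv_into_f_f inj_on_flat)

end

section \<open>Metric manifolds with \<open>F\<^sup>2 = Id\<close>\<close>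

lemma scaleR_fun_apply [simp]: "(r *\<^sub>R f) x = r *\<^sub>R f x"
  by (simp add: scaleR_fun_def)

lemma gsec_components [simp]: "fst \<circ> (X \<oplus> \<xi>) = X" "snd \<circ> (X \<oplus> \<xi>) = \<xi>"
  by (auto simp: gsec_def)

locale metric_product = metric_atlas A g
  for A :: "('a::{t2_space,second_countable_topology}, 'n::finite) chart set"
    and g :: "('a, 'n) metric" +
  fixes F :: "('a, 'n) vfield \<Rightarrow> ('a, 'n) vfield" and \<epsilon> :: real
  assumes sign: "\<epsilon> \<in> {1, -1}"
    and endomorphism: "module_endomorphism A (vector_fields A) F"
    and F_F: "X \<in> vector_fields A \<Longrightarrow> F (F X) = X"
    and on_sections_F: "X \<in> vector_fields A \<Longrightarrow> Y \<in> vector_fields A \<Longrightarrow>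
      on_sections g (F X) (F Y) = \<epsilon> *\<^sub>R on_sections g X Y"
begin

lemma F_in: "X \<in> vector_fields A \<Longrightarrow> F X \<in> vector_fields A"
  and F_add: "X \<in> vector_fields A \<Longrightarrow> Y \<in> vector_fields A \<Longrightarrow> F (X + Y) = F X + F Y"
  and F_scale: "f \<in> smooth_functions A \<Longrightarrow> X \<in> vector_fields A \<Longrightarrow>
    F (\<lambda>p. f p *\<^sub>R X p) = (\<lambda>p. f p *\<^sub>R F X p)"
  using endomorphism unfolding module_endomorphism_def by simp_all

lemmas field_closure = F_in vector_fields_add vector_fields_scaleR

lemma F_scaleR: "X \<in> vector_fields A \<Longrightarrow> F (a *\<^sub>R X) = a *\<^sub>R F X"
  using F_scale[OF smooth_functions_const, of X a]
  by (simp add: scaleR_fun_def[of a X] scaleR_fun_def[of a "F X"])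

lemma sign_square: "\<epsilon> * \<epsilon> = 1"
  using sign by auto

section \<open>Bilinear algebra of \<open>g\<close> and \<open>F\<close> on vector fields\<close>

lemma g_F_F:
  "X \<in> vector_fields A \<Longrightarrow> Y \<in> vector_fields A \<Longrightarrow> g p (F X p) (F Y p) = \<epsilon> * g p (X p) (Y p)"
  using fun_cong[OF on_sections_F[of X Y], of p] by (simp add: on_sections_def)

text \<open>Put \<open>F Y\<close> for \<open>Y\<close> in \<open>g_F_F\<close> and use F(FY) =
  Y.\<close>

lemma g_F_left:
  "X \<in> vector_fields A \<Longrightarrow> Y \<in> vector_fields A \<Longrightarrow> g p (F X p) (Y p) = \<epsilon> * g p (X p) (F Y p)"
  using g_F_F[of X "F Y" p] by (simp add: F_F F_in)

lemma g_fields_sym: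
  "X \<in> vector_fields A \<Longrightarrow> Y \<in> vector_fields A \<Longrightarrow> g p (X p) (Y p) = g p (Y p) (X p)"
  by (intro g_sym vector_fieldsD)

lemma g_fields_0:
  assumes "X \<in> vector_fields A"
  shows "g p 0 (X p) = 0" "g p (X p) 0 = 0"
proof -
  show "g p 0 (X p) = 0"
    using g_scale[OF tangent_space_0 vector_fieldsD[OF assms], of p 0] by simp
  then show "g p (X p) 0 = 0"
    using g_fields_sym[OF assms vector_fields_0] by simp
qed

lemma g_fields_lin:
  "X \<in> vector_fields A \<Longrightarrow> Y \<in> vector_fields A \<Longrightarrow> Z \<in> vector_fields A \<Longrightarrow>
    g p ((X + Y) p) (Z p) = g p (X p) (Z p) + g p (Y p) (Z p)"
  "X \<in> vector_fields A \<Longrightarrow> Z \<in> vector_fields A \<Longrightarrow> g p ((a *\<^sub>R X) p) (Z p) = a * g p (X p) (Z p)"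
  by (simp_all add: g_add g_scale vector_fieldsD)

lemma g_fields_add_right:
  assumes "X \<in> vector_fields A" "Y \<in> vector_fields A" "Z \<in> vector_fields A"
  shows "g p (X p) ((Y + Z) p) = g p (X p) (Y p) + g p (X p) (Z p)"
proof -
  have "g p (X p) ((Y + Z) p) = g p ((Y + Z) p) (X p)"
    using assms by (intro g_fields_sym vector_fields_add)
  also have "\<dots> = g p (Y p) (X p) + g p (Z p) (X p)" using assms by (intro g_fields_lin)
  finally show ?thesis using assms by (metis g_fields_sym)
qed

text \<open>Positive dimension and nondegeneracy provide test fields that detect a scalar factor in
  front of \<open>g\<close>; they serve both non-compatibility for \<epsilon> = 1 and uniqueness of
  the sign.\<close>

lemma ex_g_nonzero:
  obtains X Y p where "X \<in> vector_fields A" "Y \<in> vector_fields A" "g p (X p) (Y p) \<noteq> 0"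
proof -
  obtain p :: 'a and v where v: "v \<in> tangent_space A p" "v \<noteq> 0" using ex_nonzero_tangent by blast
  then obtain w where w: "w \<in> tangent_space A p" "g p v w \<noteq> 0" using g_nondegenerate by blast
  obtain X where "X \<in> vector_fields A" "X p = v" using v(1) by (rule vector_field_through)
  moreover obtain Y where "Y \<in> vector_fields A" "Y p = w" using w(1) by (rule vector_field_through)
  ultimately show thesis using w(2) by (intro that[of X Y p]) simp_all
qed

text \<open>\<open>dual_map\<close> is a definite description, so existence and uniqueness are both
  due: \<open>flat A g (\<epsilon> *\<^sub>R F Z)\<close> has the right values because \<epsilon>^2
  = 1, and vector fields separate 1-forms. As \<open>flat\<close> is onto, this computes the dual
  map on all 1-forms.\<close>

lemma dual_map_flat:
  assumes "Z \<in> vector_fields A"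
  shows "dual_map A F (flat A g Z) = flat A g (\<epsilon> *\<^sub>R F Z)"
  unfolding dual_map_def
proof (rule the_equality)
  have FZ: "\<epsilon> *\<^sub>R F Z \<in> vector_fields A" using assms by (intro vector_fields_scaleR F_in)
  have pair: "pairing (flat A g (\<epsilon> *\<^sub>R F Z)) X = pairing (flat A g Z) (F X)"
    if X: "X \<in> vector_fields A" for X
  proof
    fix p
    have "pairing (flat A g (\<epsilon> *\<^sub>R F Z)) X p = \<epsilon> * g p (F Z p) (X p)"
      unfolding pairing_def flat_apply[OF vector_fieldsD[OF X]] by (intro g_fields_lin F_in assms X)
    also have "\<dots> = \<epsilon> * \<epsilon> * g p (Z p) (F X p)" using g_F_left[OF assms X] by simp
    also have "\<dots> = pairing (flat A g Z) (F X) p"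
      by (simp add: sign_square pairing_def flat_apply vector_fieldsD F_in X)
    finally show "pairing (flat A g (\<epsilon> *\<^sub>R F Z)) X p = pairing (flat A g Z) (F X) p" .
  qed
  with FZ show "flat A g (\<epsilon> *\<^sub>R F Z) \<in> one_forms A \<and>
      (\<forall>X\<in>vector_fields A. pairing (flat A g (\<epsilon> *\<^sub>R F Z)) X = pairing (flat A g Z) (F X))"
    by (auto intro: flat_in)
  fix \<zeta> assume "\<zeta> \<in> one_forms A \<and> (\<forall>X\<in>vector_fields A. pairing \<zeta> X = pairing (flat A g Z) (F X))"
  with pair FZ show "\<zeta> = flat A g (\<epsilon> *\<^sub>R F Z)" by (intro one_form_eqI flat_in) auto
qed

lemma flat_scaleR: "X \<in> vector_fields A \<Longrightarrow> flat A g (a *\<^sub>R X) = a *\<^sub>R flat A g X"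
  using flat_scale[of X "\<lambda>p. a"] by (simp add: scaleR_fun_def[of a X] scaleR_fun_def[of a "flat A g X"])

text \<open>The two signs cancel up to -1, so in terms of \<open>Z\<close> the lower right block is
  -F for either value of \<epsilon>.\<close>

lemma dual_block:
  assumes "Z \<in> vector_fields A"
  shows "(- \<epsilon>) *\<^sub>R dual_map A F (flat A g Z) = flat A g ((-1) *\<^sub>R F Z)"
  using assms sign_square by (simp only: dual_map_flat flat_scaleR F_in scaleR_scaleR mult_minus_left)

section \<open>The two structures as operators on pairs of vector fields\<close>

lemma F_flat_eq:
  assumes "X \<in> vector_fields A" "Z \<in> vector_fields A"
  shows "F_flat \<epsilon> A F g (X \<oplus> flat A g Z) = F X \<oplus> flat A g (X + (-1) *\<^sub>R F Z)"
  unfolding F_flat_def block_def gsec_components dual_block[OF assms(2)]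
  using assms by (simp only: flat_add F_in vector_fields_scaleR add_0_right)

lemma F_sharp_eq:
  assumes "X \<in> vector_fields A" "Z \<in> vector_fields A"
  shows "F_sharp \<epsilon> A F g (X \<oplus> flat A g Z) = (F X + Z) \<oplus> flat A g ((-1) *\<^sub>R F Z)"
  unfolding F_sharp_def block_def gsec_components dual_block[OF assms(2)] sharp_flat[OF assms(2)]
  by (simp only: add_0_left)

text \<open>Surjectivity of \<open>flat\<close> enters through \<open>sharp\<close>: from here on a
  section is a pair \<open>X\<close>, \<open>Z\<close> of vector fields.\<close>

lemma gsections_cases:
  assumes "u \<in> gsections A"
  obtains X Z where "X \<in> vector_fields A" "Z \<in> vector_fields A" "u = X \<oplus> flat A g Z"
proof (rule that)
  show "fst \<circ> u \<in> vector_fields A" "sharp A g (snd \<circ> u) \<in> vector_fields A"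
    using assms by (auto simp: gsections_def sharp_in)
  show "u = (fst \<circ> u) \<oplus> flat A g (sharp A g (snd \<circ> u))"
    using assms by (auto simp: gsections_def flat_sharp gsec_def)
qed

lemma gsec_flat_in:
  "X \<in> vector_fields A \<Longrightarrow> Z \<in> vector_fields A \<Longrightarrow> X \<oplus> flat A g Z \<in> gsections A"
  by (simp add: gsections_def flat_in)

lemma gsec_flat_add:
  "Z \<in> vector_fields A \<Longrightarrow> W \<in> vector_fields A \<Longrightarrow>
    (X \<oplus> flat A g Z) + (Y \<oplus> flat A g W) = (X + Y) \<oplus> flat A g (Z + W)"
  by (simp add: gsec_def flat_add fun_eq_iff)

lemma gsec_flat_scale:
  "Z \<in> vector_fields A \<Longrightarrow>
    (\<lambda>p. f p *\<^sub>R (X \<oplus> flat A g Z) p) = (\<lambda>p. f p *\<^sub>R X p) \<oplus> flat A g (\<lambda>p. f p *\<^sub>R Z p)"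
  by (simp add: gsec_def flat_scale)

text \<open>\<open>P\<close> and \<open>Q\<close> are the components of \<open>K\<close> under the
  identification of pairs (X, Z) with sections. Since \<open>flat\<close> is linear over the smooth
  functions, the axioms for \<open>K\<close> reduce to those for the pair.\<close>

lemma gen_almost_productI:
  assumes K: "\<And>X Z. X \<in> vector_fields A \<Longrightarrow> Z \<in> vector_fields A \<Longrightarrow>
      K (X \<oplus> flat A g Z) = P X Z \<oplus> flat A g (Q X Z)"
    and mem: "\<And>X Z. X \<in> vector_fields A \<Longrightarrow> Z \<in> vector_fields A \<Longrightarrow>
      P X Z \<in> vector_fields A \<and> Q X Z \<in> vector_fields A"
    and add: "\<And>X Y Z W. X \<in> vector_fields A \<Longrightarrow> Y \<in> vector_fields A \<Longrightarrow>
      Z \<in> vector_fields A \<Longrightarrow> W \<in> vector_fields A \<Longrightarrow>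
      P (X + Y) (Z + W) = P X Z + P Y W \<and> Q (X + Y) (Z + W) = Q X Z + Q Y W"
    and scale: "\<And>f X Z. f \<in> smooth_functions A \<Longrightarrow> X \<in> vector_fields A \<Longrightarrow> Z \<in> vector_fields A \<Longrightarrow>
      P (\<lambda>p. f p *\<^sub>R X p) (\<lambda>p. f p *\<^sub>R Z p) = (\<lambda>p. f p *\<^sub>R P X Z p) \<and>
      Q (\<lambda>p. f p *\<^sub>R X p) (\<lambda>p. f p *\<^sub>R Z p) = (\<lambda>p. f p *\<^sub>R Q X Z p)"
    and invol: "\<And>X Z. X \<in> vector_fields A \<Longrightarrow> Z \<in> vector_fields A \<Longrightarrow>
      P (P X Z) (Q X Z) = X \<and> Q (P X Z) (Q X Z) = Z"
  shows "gen_almost_product A K"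
  unfolding gen_almost_product_def module_endomorphism_def
proof (intro conjI ballI)
  fix u assume "u \<in> gsections A"
  then obtain X Z where X: "X \<in> vector_fields A" "Z \<in> vector_fields A" "u = X \<oplus> flat A g Z"
    by (rule gsections_cases)
  then show "K u \<in> gsections A" using mem[of X Z] by (simp add: K gsec_flat_in)
  show "K (K u) = u" using X mem[of X Z] invol[of X Z] by (simp add: K)
  show "K (\<lambda>p. f p *\<^sub>R u p) = (\<lambda>p. f p *\<^sub>R K u p)" if f: "f \<in> smooth_functions A" for f
    using X mem[OF X(1,2)] scale[OF f X(1,2)] vector_fields_scale[OF f]
    by (simp only: gsec_flat_scale K simp_thms)
  fix v assume "v \<in> gsections A"
  then obtain Y W where Y: "Y \<in> vector_fields A" "W \<in> vector_fields A" "v = Y \<oplus> flat A g W"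
    by (rule gsections_cases)
  show "K (u + v) = K u + K v"
    using X Y mem[of X Z] mem[of Y W] add[OF X(1) Y(1) X(2) Y(2)]
    by (simp only: gsec_flat_add K vector_fields_add simp_thms)
qed

lemma gen_almost_product_F_flat: "gen_almost_product A (F_flat \<epsilon> A F g)"
proof (rule gen_almost_productI[where P = "\<lambda>X Z. F X" and Q = "\<lambda>X Z. X + (-1) *\<^sub>R F Z", OF F_flat_eq];
    (intro conjI)?)
  fix X Z assume X: "X \<in> vector_fields A" "Z \<in> vector_fields A"
  show "F X \<in> vector_fields A" "X + (-1) *\<^sub>R F Z \<in> vector_fields A"
    using X by (simp_all only: field_closure)
  show "F (F X) = X" using X by (simp add: F_F)
  have "F (X + (-1) *\<^sub>R F Z) = F X + (-1) *\<^sub>R Z"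
    using X by (simp only: F_add F_scaleR F_F F_in vector_fields_scaleR)
  then show "F X + (-1) *\<^sub>R F (X + (-1) *\<^sub>R F Z) = Z" by simp
  fix f assume f: "f \<in> smooth_functions A"
  show "F (\<lambda>p. f p *\<^sub>R X p) = (\<lambda>p. f p *\<^sub>R F X p)" using F_scale[OF f X(1)] .
  show "(\<lambda>p. f p *\<^sub>R X p) + (-1) *\<^sub>R F (\<lambda>p. f p *\<^sub>R Z p) = (\<lambda>p. f p *\<^sub>R (X + (-1) *\<^sub>R F Z) p)"
    by (intro ext) (simp add: F_scale[OF f X(2)] algebra_simps)
next
  fix X Y Z W
  assume X: "X \<in> vector_fields A" "Y \<in> vector_fields A" "Z \<in> vector_fields A" "W \<in> vector_fields A"
  show "F (X + Y) = F X + F Y" using X by (simp add: F_add)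
  show "X + Y + (-1) *\<^sub>R F (Z + W) = X + (-1) *\<^sub>R F Z + (Y + (-1) *\<^sub>R F W)"
    using X by (simp add: F_add)
qed

lemma gen_almost_product_F_sharp: "gen_almost_product A (F_sharp \<epsilon> A F g)"
proof (rule gen_almost_productI[where P = "\<lambda>X Z. F X + Z" and Q = "\<lambda>X Z. (-1) *\<^sub>R F Z", OF F_sharp_eq];
    (intro conjI)?)
  fix X Z assume X: "X \<in> vector_fields A" "Z \<in> vector_fields A"
  show "F X + Z \<in> vector_fields A" "(-1) *\<^sub>R F Z \<in> vector_fields A"
    using X by (simp_all only: field_closure)
  show "F (F X + Z) + (-1) *\<^sub>R F Z = X" using X by (simp add: F_F F_add F_in)
  have "F ((-1) *\<^sub>R F Z) = (-1) *\<^sub>R Z" using X by (simp only: F_scaleR F_F F_in)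
  then show "(-1) *\<^sub>R F ((-1) *\<^sub>R F Z) = Z" by simp
  fix f assume f: "f \<in> smooth_functions A"
  show "F (\<lambda>p. f p *\<^sub>R X p) + (\<lambda>p. f p *\<^sub>R Z p) = (\<lambda>p. f p *\<^sub>R (F X + Z) p)"
    by (intro ext) (simp add: F_scale[OF f X(1)] algebra_simps)
  show "(-1) *\<^sub>R F (\<lambda>p. f p *\<^sub>R Z p) = (\<lambda>p. f p *\<^sub>R ((-1) *\<^sub>R F Z) p)"
    by (intro ext) (simp add: F_scale[OF f X(2)] algebra_simps)
next
  fix X Y Z W
  assume X: "X \<in> vector_fields A" "Y \<in> vector_fields A" "Z \<in> vector_fields A" "W \<in> vector_fields A"
  show "F (X + Y) + (Z + W) = F X + Z + (F Y + W)" using X by (simp add: F_add)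
  show "(-1) *\<^sub>R F (Z + W) = (-1) *\<^sub>R F Z + (-1) *\<^sub>R F W"
    using X by (simp add: F_add)
qed

section \<open>The natural metric pulled back by the two structures\<close>

lemma G0_flat:
  "X \<in> vector_fields A \<Longrightarrow> Y \<in> vector_fields A \<Longrightarrow>
    on_sections \<G>\<^sub>0 (X \<oplus> flat A g Z) (Y \<oplus> flat A g W) p = (g p (Z p) (Y p) + g p (W p) (X p)) / 2"
  by (simp add: on_sections_def natural_gmetric_def gsec_def flat_apply vector_fieldsD)

text \<open>The terms with \<open>F Z\<close> and \<open>F W\<close> produce -\<epsilon> times the
  original metric by \<open>g_F_F\<close>. What remains is half of g(X, FY) + g(Y, FX), whose second
  term is \<epsilon> times the first.\<close>

lemma G0_F_flat:
  assumes V: "X \<in> vector_fields A" "Y \<in> vector_fields A" "Z \<in> vector_fields A" "W \<in> vector_fields A"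
    and u: "u = X \<oplus> flat A g Z" "v = Y \<oplus> flat A g W"
  shows "on_sections \<G>\<^sub>0 (F_flat \<epsilon> A F g u) (F_flat \<epsilon> A F g v) p =
    - \<epsilon> * on_sections \<G>\<^sub>0 u v p + (1 + \<epsilon>) / 2 * g p (X p) (F Y p)"
proof -
  have "g p (Y p) (F X p) = \<epsilon> * g p (X p) (F Y p)"
    using V g_F_left[of X Y p] g_fields_sym[of "F X" Y p] by (simp add: F_in)
  then show ?thesis
    unfolding u using V
    by (simp only: F_flat_eq G0_flat g_fields_lin g_F_F field_closure) (simp add: field_simps)
qed

text \<open>Here the excess is minus half of g(FZ, W) + g(FW, Z), and adjointness again merges the
  two terms with the factor 1 + \<epsilon>.\<close>

lemma G0_F_sharp:
  assumes V: "X \<in> vector_fields A" "Y \<in> vector_fields A" "Z \<in> vector_fields A" "W \<in> vector_fields A"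
    and u: "u = X \<oplus> flat A g Z" "v = Y \<oplus> flat A g W"
  shows "on_sections \<G>\<^sub>0 (F_sharp \<epsilon> A F g u) (F_sharp \<epsilon> A F g v) p =
    - \<epsilon> * on_sections \<G>\<^sub>0 u v p - (1 + \<epsilon>) / 2 * g p (Z p) (F W p)"
proof -
  have "g p (F W p) (Z p) = g p (Z p) (F W p)" using V by (intro g_fields_sym F_in)
  then have "g p (F Z p) ((F Y + W) p) = \<epsilon> * g p (Z p) (Y p) + \<epsilon> * g p (Z p) (F W p)"
    "g p (F W p) ((F X + Z) p) = \<epsilon> * g p (W p) (X p) + g p (Z p) (F W p)"
    using V g_F_left[of Z W p] by (simp_all only: g_fields_add_right g_F_F F_in)
  then show ?thesis
    unfolding u using V
    by (simp only: F_sharp_eq G0_flat g_fields_lin(2) field_closure) (simp add: field_simps)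
qed

lemma isometry_if_para:
  assumes "\<epsilon> = -1" "u \<in> gsections A" "v \<in> gsections A"
  shows "on_sections \<G>\<^sub>0 (F_flat \<epsilon> A F g u) (F_flat \<epsilon> A F g v) = on_sections \<G>\<^sub>0 u v"
    and "on_sections \<G>\<^sub>0 (F_sharp \<epsilon> A F g u) (F_sharp \<epsilon> A F g v) = on_sections \<G>\<^sub>0 u v"
proof -
  obtain X Z where u: "X \<in> vector_fields A" "Z \<in> vector_fields A" "u = X \<oplus> flat A g Z"
    using assms(2) by (rule gsections_cases)
  obtain Y W where v: "Y \<in> vector_fields A" "W \<in> vector_fields A" "v = Y \<oplus> flat A g W"
    using assms(3) by (rule gsections_cases)
  show "on_sections \<G>\<^sub>0 (F_flat \<epsilon> A F g u) (F_flat \<epsilon> A F g v) = on_sections \<G>\<^sub>0 u v"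
    "on_sections \<G>\<^sub>0 (F_sharp \<epsilon> A F g u) (F_sharp \<epsilon> A F g v) = on_sections \<G>\<^sub>0 u v"
    using G0_F_flat[OF u(1) v(1) u(2) v(2) u(3) v(3)] G0_F_sharp[OF u(1) v(1) u(2) v(2) u(3) v(3)]
      assms(1) by (auto intro!: ext)
qed

lemma compatible_F_flat_iff: "compatible A (F_flat \<epsilon> A F g) \<G>\<^sub>0 \<longleftrightarrow> \<epsilon> = -1"
proof
  assume "compatible A (F_flat \<epsilon> A F g) \<G>\<^sub>0"
  then obtain \<delta> where \<delta>: "\<And>u v. u \<in> gsections A \<Longrightarrow> v \<in> gsections A \<Longrightarrow>
      on_sections \<G>\<^sub>0 (F_flat \<epsilon> A F g u) (F_flat \<epsilon> A F g v) = \<delta> *\<^sub>R on_sections \<G>\<^sub>0 u v"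
    unfolding compatible_def by blast
  obtain X Y p where X: "X \<in> vector_fields A" "Y \<in> vector_fields A" "g p (X p) (Y p) \<noteq> 0"
    by (rule ex_g_nonzero)
  \<comment> \<open>Tangent sections are null for \<open>\<G>\<^sub>0\<close>, so \<delta> drops out
    and only the excess term is left. The choice of \<open>F Y\<close> turns its entry F(FY) into
    \<open>Y\<close>. The zero form is written as \<open>flat A g 0\<close> to fit the normal form
    of sections.\<close>
  let ?u = "X \<oplus> flat A g 0" and ?v = "F Y \<oplus> flat A g 0"
  have "on_sections \<G>\<^sub>0 ?u ?v p = 0" using X by (simp add: G0_flat F_in g_fields_0)
  then have "(1 + \<epsilon>) / 2 * g p (X p) (Y p) = 0"
    using fun_cong[OF \<delta>[of ?u ?v], of p]
      G0_F_flat[OF X(1) F_in[OF X(2)] vector_fields_0 vector_fields_0 refl refl, of p]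
    by (simp add: gsec_flat_in vector_fields_0 X F_in F_F)
  with X(3) show "\<epsilon> = -1" by simp
next
  assume "\<epsilon> = -1"
  from isometry_if_para(1)[OF this] show "compatible A (F_flat \<epsilon> A F g) \<G>\<^sub>0"
    unfolding compatible_def by (intro bexI[of _ 1] ballI) simp_all
qed

lemma compatible_F_sharp_iff: "compatible A (F_sharp \<epsilon> A F g) \<G>\<^sub>0 \<longleftrightarrow> \<epsilon> = -1"
proof
  assume "compatible A (F_sharp \<epsilon> A F g) \<G>\<^sub>0"
  then obtain \<delta> where \<delta>: "\<And>u v. u \<in> gsections A \<Longrightarrow> v \<in> gsections A \<Longrightarrow>
      on_sections \<G>\<^sub>0 (F_sharp \<epsilon> A F g u) (F_sharp \<epsilon> A F g v) = \<delta> *\<^sub>R on_sections \<G>\<^sub>0 u v"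
    unfolding compatible_def by blast
  obtain Z W p where Z: "Z \<in> vector_fields A" "W \<in> vector_fields A" "g p (Z p) (W p) \<noteq> 0"
    by (rule ex_g_nonzero)
  \<comment> \<open>Here purely cotangent sections isolate the excess term, which pairs
    \<open>Z\<close> with F(FW) = W.\<close>
  let ?u = "0 \<oplus> flat A g Z" and ?v = "0 \<oplus> flat A g (F W)"
  have "on_sections \<G>\<^sub>0 ?u ?v p = 0" using Z by (simp add: G0_flat F_in g_fields_0 vector_fields_0)
  then have "(1 + \<epsilon>) / 2 * g p (Z p) (W p) = 0"
    using fun_cong[OF \<delta>[of ?u ?v], of p]
      G0_F_sharp[OF vector_fields_0 vector_fields_0 Z(1) F_in[OF Z(2)] refl refl, of p]
    by (simp add: gsec_flat_in vector_fields_0 Z F_in F_F)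
  with Z(3) show "\<epsilon> = -1" by simp
next
  assume "\<epsilon> = -1"
  from isometry_if_para(2)[OF this] show "compatible A (F_sharp \<epsilon> A F g) \<G>\<^sub>0"
    unfolding compatible_def by (intro bexI[of _ 1] ballI) simp_all
qed

text \<open>For nondegeneracy, testing against (v, 0) kills the covector part. Testing against (0,
  flat v) then kills the tangent part: \<open>g\<close> supplies enough covectors, and its own
  nondegeneracy concludes.\<close>

lemma bundle_metric_G0: "bundle_metric A (gtangent_space A) (gsections A) \<G>\<^sub>0"
  unfolding bundle_metric_def
proof (intro conjI allI ballI impI)
  fix p u v assume u: "u \<in> gtangent_space A p" and v: "v \<in> gtangent_space A p"
  show "\<G>\<^sub>0 p u v = \<G>\<^sub>0 p v u" by (simp add: natural_gmetric_def)
  fix w a b assume w: "w \<in> gtangent_space A p"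
  have "snd w (a *\<^sub>R fst u + b *\<^sub>R fst v) = a * snd w (fst u) + b * snd w (fst v)"
    using u v w unfolding gtangent_space_def cotangent_space_def by auto
  then show "\<G>\<^sub>0 p (a *\<^sub>R u + b *\<^sub>R v) w = a * \<G>\<^sub>0 p u w + b * \<G>\<^sub>0 p v w"
    by (simp add: natural_gmetric_def field_simps)
next
  fix p u assume u: "u \<in> gtangent_space A p" and z: "\<forall>v\<in>gtangent_space A p. \<G>\<^sub>0 p u v = 0"
  have fst_u: "fst u \<in> tangent_space A p" and snd_u: "snd u \<in> cotangent_space A p"
    using u by (auto simp: gtangent_space_def)
  have eq: "snd u v + \<omega> (fst u) = 0" if "v \<in> tangent_space A p" "\<omega> \<in> cotangent_space A p" for v \<omega>
    using z[rule_format, of "(v, \<omega>)"] that by (simp add: gtangent_space_def natural_gmetric_def)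
  have "snd u = 0"
    using eq[OF _ cotangent_space_0] by (intro cotangent_eqI[OF snd_u cotangent_space_0]) simp
  moreover have "fst u = 0"
  proof (rule g_nondegenerate[OF fst_u])
    fix v assume v: "v \<in> tangent_space A p"
    then show "g p (fst u) v = 0"
      using eq[OF tangent_space_0 flat_at_in[OF v]] fst_u \<open>snd u = 0\<close> g_sym[OF fst_u v] by simp
  qed
  ultimately show "u = 0" by (simp add: prod_eq_iff)
next
  fix u v assume u: "u \<in> gsections A" and v: "v \<in> gsections A"
  have "pairing (snd \<circ> u) (fst \<circ> v) \<in> smooth_functions A" "pairing (snd \<circ> v) (fst \<circ> u) \<in> smooth_functions A"
    using u v by (auto simp: gsections_def pairing_smooth)
  from smooth_functions_mult[OF smooth_functions_const[of "1/2"] smooth_functions_add[OF this]]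
  show "on_sections \<G>\<^sub>0 u v \<in> smooth_functions A"
    by (simp add: on_sections_def natural_gmetric_def pairing_def)
qed

lemma not_positive_definite_G0: "\<not> positive_definite (gtangent_space A) \<G>\<^sub>0"
proof
  assume pos: "positive_definite (gtangent_space A) \<G>\<^sub>0"
  obtain v where v: "v \<in> tangent_space A undefined" "v \<noteq> 0" using ex_nonzero_tangent by blast
  \<comment> \<open>A nonzero tangent vector with zero covector part is null;
    \<open>undefined\<close> serves as an arbitrary point of the manifold.\<close>
  then have "(v, 0) \<in> gtangent_space A undefined" by (simp add: gtangent_space_def cotangent_space_0)
  then have "\<G>\<^sub>0 undefined (v, 0) (v, 0) > 0"
    by (rule pos[unfolded positive_definite_def, rule_format]) (simp add: v(2) prod_eq_iff)
  then show False by (simp add: natural_gmetric_def)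
qed

lemma twin_metrics:
  assumes "\<epsilon> = -1" "X \<in> vector_fields A" "Y \<in> vector_fields A" "\<xi> \<in> one_forms A" "\<eta> \<in> one_forms A"
  shows "twin_metric \<G>\<^sub>0 (F_flat \<epsilon> A F g) (X \<oplus> \<xi>) (Y \<oplus> \<eta>) =
      on_sections \<G>\<^sub>0 (F X \<oplus> \<xi>) (F Y \<oplus> \<eta>) + (1/2) *\<^sub>R on_sections g X Y"
    and "twin_metric \<G>\<^sub>0 (F_sharp \<epsilon> A F g) (X \<oplus> \<xi>) (Y \<oplus> \<eta>) =
      on_sections \<G>\<^sub>0 (F X \<oplus> \<xi>) (F Y \<oplus> \<eta>) + (1/2) *\<^sub>R on_sections g (sharp A g \<xi>) (sharp A g \<eta>)"
proof -
  define Z W where "Z = sharp A g \<xi>" and "W = sharp A g \<eta>"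
  have V: "X \<in> vector_fields A" "Y \<in> vector_fields A" "Z \<in> vector_fields A" "W \<in> vector_fields A"
    using assms by (auto simp: Z_def W_def sharp_in)
  have \<xi>: "\<xi> = flat A g Z" "\<eta> = flat A g W"
    using assms by (auto simp: Z_def W_def flat_sharp)
  \<comment> \<open>For \<epsilon> = -1 the operator \<open>F\<close> is skew, which moves it from
    \<open>Z\<close> to \<open>Y\<close> and yields the term \<xi>(FY) of the right-hand
    side.\<close>
  have adj: "g p (F Z p) (Y p) = - g p (Z p) (F Y p)" for p
    using g_F_left[OF V(3,2)] assms(1) by simp
  show "twin_metric \<G>\<^sub>0 (F_flat \<epsilon> A F g) (X \<oplus> \<xi>) (Y \<oplus> \<eta>) =
      on_sections \<G>\<^sub>0 (F X \<oplus> \<xi>) (F Y \<oplus> \<eta>) + (1/2) *\<^sub>R on_sections g X Y"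
  proof
    fix p
    have "twin_metric \<G>\<^sub>0 (F_flat \<epsilon> A F g) (X \<oplus> \<xi>) (Y \<oplus> \<eta>) p =
        (g p (X p) (Y p) + g p (Z p) (F Y p) + g p (W p) (F X p)) / 2"
      unfolding twin_metric_def \<xi> using V
      by (simp only: F_flat_eq G0_flat g_fields_lin field_closure adj) simp
    then show "twin_metric \<G>\<^sub>0 (F_flat \<epsilon> A F g) (X \<oplus> \<xi>) (Y \<oplus> \<eta>) p =
        (on_sections \<G>\<^sub>0 (F X \<oplus> \<xi>) (F Y \<oplus> \<eta>) + (1/2) *\<^sub>R on_sections g X Y) p"
      using V by (simp add: \<xi> G0_flat F_in on_sections_def[of g] field_simps)
  qed
  show "twin_metric \<G>\<^sub>0 (F_sharp \<epsilon> A F g) (X \<oplus> \<xi>) (Y \<oplus> \<eta>) =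
      on_sections \<G>\<^sub>0 (F X \<oplus> \<xi>) (F Y \<oplus> \<eta>) + (1/2) *\<^sub>R on_sections g (sharp A g \<xi>) (sharp A g \<eta>)"
    unfolding Z_def[symmetric] W_def[symmetric]
  proof
    fix p
    have "g p (W p) ((F X + Z) p) = g p (W p) (F X p) + g p (Z p) (W p)"
      using V g_fields_sym[of W Z p] by (simp only: g_fields_add_right F_in)
    then have "twin_metric \<G>\<^sub>0 (F_sharp \<epsilon> A F g) (X \<oplus> \<xi>) (Y \<oplus> \<eta>) p =
        (g p (Z p) (F Y p) + g p (W p) (F X p) + g p (Z p) (W p)) / 2"
      unfolding twin_metric_def \<xi> using V
      by (simp only: F_sharp_eq G0_flat g_fields_lin(2) field_closure adj) simp
    then show "twin_metric \<G>\<^sub>0 (F_sharp \<epsilon> A F g) (X \<oplus> \<xi>) (Y \<oplus> \<eta>) p =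
        (on_sections \<G>\<^sub>0 (F X \<oplus> \<xi>) (F Y \<oplus> \<eta>) + (1/2) *\<^sub>R on_sections g Z W) p"
      using V by (simp add: \<xi> G0_flat F_in on_sections_def[of g] field_simps)
  qed
qed

text \<open>\<open>almost_para_hermitian\<close> asserts the structure with sign -1 independently of
  the given \<epsilon>. To conclude \<epsilon> = -1 from it, the sign must be determined by
  \<open>F\<close> and \<open>g\<close>.\<close>

lemma sign_unique:
  assumes "metric_manifold \<alpha> \<epsilon>' A F g"
  shows "\<epsilon> = \<epsilon>'"
proof -
  obtain X Y p where X: "X \<in> vector_fields A" "Y \<in> vector_fields A" "g p (X p) (Y p) \<noteq> 0"
    by (rule ex_g_nonzero)
  have "on_sections g (F X) (F Y) = \<epsilon>' *\<^sub>R on_sections g X Y"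
    using assms X by (simp add: metric_manifold_def)
  from fun_cong[OF this, of p] X show ?thesis by (simp add: on_sections_def g_F_F)
qed

end

theorem proposition4p10:
  fixes A :: "('a::{t2_space,second_countable_topology}, 'n::finite) chart set"
    and F :: "('a, 'n) vfield \<Rightarrow> ('a, 'n) vfield"
    and g :: "('a, 'n) metric"
    and \<epsilon> :: real
  assumes "metric_manifold 1 \<epsilon> A F g"
  shows "gen_almost_product A (F_flat \<epsilon> A F g) \<and>
    gen_almost_product A (F_sharp \<epsilon> A F g) \<and>
    (compatible A (F_flat \<epsilon> A F g) \<G>\<^sub>0 \<longleftrightarrow> \<epsilon> = -1) \<and>
    (compatible A (F_sharp \<epsilon> A F g) \<G>\<^sub>0 \<longleftrightarrow> \<epsilon> = -1) \<and>
    (\<epsilon> = -1 \<longleftrightarrow> almost_para_hermitian A F g) \<and>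
    (\<epsilon> = -1 \<longrightarrow>
      gen_pseudo_riemannian_almost_product A (F_flat \<epsilon> A F g) \<G>\<^sub>0 \<and>
      gen_pseudo_riemannian_almost_product A (F_sharp \<epsilon> A F g) \<G>\<^sub>0 \<and>
      (\<forall>X\<in>vector_fields A. \<forall>Y\<in>vector_fields A. \<forall>\<xi>\<in>one_forms A. \<forall>\<eta>\<in>one_forms A.
         twin_metric \<G>\<^sub>0 (F_flat \<epsilon> A F g) (X \<oplus> \<xi>) (Y \<oplus> \<eta>) =
           on_sections \<G>\<^sub>0 (F X \<oplus> \<xi>) (F Y \<oplus> \<eta>) + (1/2) *\<^sub>R on_sections g X Y \<and>
         twin_metric \<G>\<^sub>0 (F_sharp \<epsilon> A F g) (X \<oplus> \<xi>) (Y \<oplus> \<eta>) =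
           on_sections \<G>\<^sub>0 (F X \<oplus> \<xi>) (F Y \<oplus> \<eta>)
           + (1/2) *\<^sub>R on_sections g (sharp A g \<xi>) (sharp A g \<eta>)))"
proof -
  interpret metric_product A g F \<epsilon>
    by unfold_locales
      (use assms in \<open>auto simp: metric_manifold_def riemannian_metric_def pseudo_riemannian_metric_def\<close>)
  have para: "\<epsilon> = -1 \<longleftrightarrow> almost_para_hermitian A F g"
    using assms sign_unique unfolding almost_para_hermitian_def by blast
  have pseudo: "gen_pseudo_riemannian_almost_product A (F_flat \<epsilon> A F g) \<G>\<^sub>0"
      "gen_pseudo_riemannian_almost_product A (F_sharp \<epsilon> A F g) \<G>\<^sub>0" if "\<epsilon> = -1"
    unfolding gen_pseudo_riemannian_almost_product_def
    by (intro conjI ballI gen_almost_product_F_flat gen_almost_product_F_sharp bundle_metric_G0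
        not_positive_definite_G0 isometry_if_para[OF that]; assumption)+
  show ?thesis
    by (intro conjI impI ballI gen_almost_product_F_flat gen_almost_product_F_sharp
        compatible_F_flat_iff compatible_F_sharp_iff para pseudo twin_metrics)
qed

end
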